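(* Let $0 \le s < \frac12$. Then the Cauchy problem for the modified Kawahara equation \[\partial_t v - \partial_x^5 v + \beta \partial_x^3 v + \gamma \partial_x v - \tfrac{\mu}{3}\partial_x (v^3) = 0,\qquad v(0)=v_0\in H^s(\mathbb T),\] is weakly ill-posed in $H^s(\mathbb T)$: the flow map is not uniformly continuous, i.e., it is not true that for every $R>0$ there exist $T>0$ and a continuous function $\zeta$ on $[0,\infty)$ with $\zeta(r)\to0$ as $r\to0$ such that any two solutions $v_1,v_2$ with $\|v_1(0)\|_{H^s},\|v_2(0)\|_{H^s}\le R$ satisfy $\|v_1-v_2\|_{C([0,T];H^s)}\le \zeta(\|v_1(0)-v_2(0)\|_{H^s})$.
   Context: $\mathbb T=\mathbb R/2\pi\mathbb Z$, $\beta\ge0$, $\gamma\in\mathbb R$, $\mu=\pm1$, and $v$ is real-valued. The solutions referred to are those given by the local well-posedness theory in $H^s(\mathbb T)$, $0\le s<\frac12$ (solutions of the Duhamel formula $v(t)=S(t)v_0+\frac{\mu}{3}\int_0^t S(t-s)\partial_x(v(s)^3)\,ds$ with $S(t)f=\frac1{2\pi}\sum_{n}e^{inx}e^{it(n^5+\beta n^3-\gamma n)}\hat f(n)$). *)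

theory Defs
  imports "HOL-Analysis.Analysis"
begin

text \<open>Functions on the torus T = R/2piZ are represented as 2pi-periodic real functions;
  Fourier coefficients: hat f(n) = integral over [0,2pi] of exp(-inx) f(x) dx, so that
  f = (1/2pi) sum_n hat f(n) exp(inx).\<close>

definition fourier_coeff :: "(real \<Rightarrow> real) \<Rightarrow> int \<Rightarrow> complex" where
  "fourier_coeff f n =
     (LINT x:{0..2*pi}|lborel. exp (- \<i> * of_int n * of_real x) * of_real (f x))"

definition hs_weight :: "real \<Rightarrow> (real \<Rightarrow> real) \<Rightarrow> int \<Rightarrow> real" where
  "hs_weight s f n = (1 + (of_int n)\<^sup>2) powr s * (cmod (fourier_coeff f n))\<^sup>2"

definition hs_norm :: "real \<Rightarrow> (real \<Rightarrow> real) \<Rightarrow> real" where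
  "hs_norm s f = sqrt ((1 / (2*pi)) * infsum (hs_weight s f) UNIV)"

definition in_Hs :: "real \<Rightarrow> (real \<Rightarrow> real) \<Rightarrow> bool" where
  "in_Hs s f \<longleftrightarrow>
     (\<forall>x. f (x + 2*pi) = f x) \<and>
     set_borel_measurable lborel {0..2*pi} f \<and>
     set_integrable lborel {0..2*pi} (\<lambda>x. (f x)\<^sup>2) \<and>
     (hs_weight s f) summable_on UNIV"

definition mk_phase :: "real \<Rightarrow> real \<Rightarrow> int \<Rightarrow> real" where
  "mk_phase \<beta> \<gamma> n = (of_int n)^5 + \<beta> * (of_int n)^3 - \<gamma> * of_int n"

definition duhamel_integrand ::
  "real \<Rightarrow> real \<Rightarrow> (real \<Rightarrow> real \<Rightarrow> real) \<Rightarrow> real \<Rightarrow> int \<Rightarrow> real \<Rightarrow> complex" where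
  "duhamel_integrand \<beta> \<gamma> v t n \<tau> =
     exp (\<i> * of_real ((t - \<tau>) * mk_phase \<beta> \<gamma> n)) * (\<i> * of_int n)
       * fourier_coeff (\<lambda>x. (v \<tau> x)^3) n"

text \<open>v (time, space) is a solution on [0,T] in H^s of the Duhamel formula
  v(t) = S(t) v(0) + (mu/3) int_0^t S(t-tau) d_x (v(tau)^3) dtau,
  with v in C([0,T]; H^s(T)); the formula is imposed coefficientwise.\<close>

definition mkaw_solution ::
  "real \<Rightarrow> real \<Rightarrow> real \<Rightarrow> real \<Rightarrow> real \<Rightarrow> (real \<Rightarrow> real \<Rightarrow> real) \<Rightarrow> bool" where
  "mkaw_solution \<beta> \<gamma> \<mu> s T v \<longleftrightarrow>
     (\<forall>t\<in>{0..T}. in_Hs s (v t)) \<and>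
     (\<forall>t0\<in>{0..T}. ((\<lambda>t. hs_norm s (\<lambda>x. v t x - v t0 x)) \<longlongrightarrow> 0) (at t0 within {0..T})) \<and>
     (\<forall>\<tau>\<in>{0..T}. set_integrable lborel {0..2*pi} (\<lambda>x. (v \<tau> x)^3)) \<and>
     (\<forall>t\<in>{0..T}. \<forall>n::int.
        set_integrable lborel {0..t} (duhamel_integrand \<beta> \<gamma> v t n) \<and>
        fourier_coeff (v t) n =
          exp (\<i> * of_real (t * mk_phase \<beta> \<gamma> n)) * fourier_coeff (v 0) n
          + of_real (\<mu> / 3) * (LINT \<tau>:{0..t}|lborel. duhamel_integrand \<beta> \<gamma> v t n \<tau>))"

end

theory Submission
  imports Defs
begin

text \<open>The flow map is tested on periodic travelling waves
  \<open>v(t,x) = a \<psi>(x + c t)\<close> with \<open>\<psi>(y) = cos (N y) + \<Sum>k\<ge>2. x\<^sub>k k\<^sup>-\<^sup>4 cos (k N y)\<close>.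
  Mode by mode the wave equation is a fixed-point problem for the bounded sequence \<open>x\<close>;
  the dispersion relation separates the harmonics \<open>kN\<close> from \<open>N\<close> by a factor of order \<open>N\<^sup>4 k\<^sup>4\<close>,
  so Picard iteration converges and \<open>x = O(N\<^sup>-\<^sup>4)\<close>, while the cubic interaction shifts the speed by
  \<open>\<mu> a\<^sup>2 / 4 + O(N\<^sup>-\<^sup>4)\<close>. Two waves with amplitudes \<open>N\<^sup>-\<^sup>s (1/2 + \<delta>)\<close> and \<open>N\<^sup>-\<^sup>s / 2\<close> therefore
  separate in phase at rate about \<open>N\<^bsup>1-2s\<^esup> \<delta> / 4\<close>. As \<open>s < 1/2\<close>, one may let \<open>\<delta> \<rightarrow> 0\<close> with this rate
  tending to infinity: the data merge in \<open>H\<^sup>s\<close>, yet within any fixed time the waves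
  are in phase opposition.\<close>

section \<open>Fourier coefficients of continuous periodic functions\<close>


text \<open>A travelling wave solves a nonlinear eigenvalue problem: profile and speed are both
  unknown, and at the wavenumber N itself the linear operator has a kernel. Evenness removes the
  translation freedom, the first harmonic is fixed at 1, and the equation of mode N is spent on
  determining the speed. What remains are the harmonics \<open>k >= 2\<close>, where the operator
  can be inverted; the inverse gains \<open>N^-4\<close>, so for amplitudes up to 1 the contraction
  comes from N alone. The waves are exact solutions, hence can be compared at any time without
  remainder estimates. Both carry the same N, so the linear speed cancels in the comparison. The
  exponent \<open>1 - 2*s\<close> is one factor N, from speed to phase of mode N, times the squared
  amplitude \<open>N^(-2*s)\<close>, from the cubic shift. The speed error of order
  \<open>N^-4\<close> enters the phase rate only at order \<open>N^-3\<close>, while T is prescribed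
  before N and requires a rate of at least \<open>pi / T\<close>.\<close>

lemma fourier_coeff_has_integral:
  fixes f :: "real \<Rightarrow> real"
  assumes "continuous_on UNIV f"
  shows "((\<lambda>x. cis (- (of_int n * x)) * of_real (f x)) has_integral fourier_coeff f n) {0..2*pi}"
proof -
  have eq: "exp (- \<i> * of_int n * of_real x) = cis (- (of_int n * x))" for x :: real
    by (simp add: cis_conv_exp mult.assoc)
  have c: "continuous_on {0..2*pi} (\<lambda>x. cis (- (of_int n * x)) * of_real (f x))"
    by (intro continuous_intros continuous_on_subset[OF assms]) auto
  then have "set_integrable lborel {0..2*pi} (\<lambda>x. cis (- (of_int n * x)) * of_real (f x))"
    by (rule borel_integrable_atLeastAtMost')
  from set_borel_integral_eq_integral[OF this] show ?thesis
    unfolding fourier_coeff_def eq has_integral_iff by (intro conjI) simp_all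
qed

lemma fourier_coeff_eq_integral:
  fixes f :: "real \<Rightarrow> real"
  assumes "continuous_on UNIV f"
  shows "fourier_coeff f n = integral {0..2*pi} (\<lambda>x. cis (- (of_int n * x)) * of_real (f x))"
  by (rule integral_unique[OF fourier_coeff_has_integral[OF assms], symmetric])

text \<open>The intervals [0,p] and [h,p+h] are completed to [0,p+h] by [p,p+h] and [0,h]
  respectively, and these carry equal integrals by periodicity. This works for
  \<open>h >= 0\<close>; a negative shift is undone by a positive shift of the translated
  function.\<close>

lemma integral_periodic_shift:
  fixes g :: "real \<Rightarrow> complex"
  assumes cont: "continuous_on UNIV g" and per: "\<And>x. g (x + p) = g x" and "p \<ge> 0"
  shows "integral {0..p} (\<lambda>x. g (x + h)) = integral {0..p} g"
proof -
  have *: "integral {0..p} (\<lambda>x. g (x + h)) = integral {0..p} g"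
    if cont: "continuous_on UNIV g" and per: "\<And>x. g (x + p) = g x" and "h \<ge> 0"
    for g :: "real \<Rightarrow> complex" and h
  proof -
    have int: "g integrable_on {a..b}" for a b
      by (intro integrable_continuous_interval continuous_on_subset[OF cont]) auto
    have "integral {0..p} (\<lambda>x. g (x + h)) = integral {h..p+h} g"
      using integral_shift_real_ivl[of h h "p+h" g] by simp
    moreover have "integral {0..h} g = integral {p..p+h} g"
      using integral_shift_real_ivl[of p p "p+h" g] by (simp add: per)
    moreover have "integral {0..h} g + integral {h..p+h} g = integral {0..p+h} g"
      using int \<open>h \<ge> 0\<close> \<open>p \<ge> 0\<close> by (intro Henstock_Kurzweil_Integration.integral_combine) auto
    moreover have "integral {0..p} g + integral {p..p+h} g = integral {0..p+h} g"
      using int \<open>h \<ge> 0\<close> \<open>p \<ge> 0\<close> by (intro Henstock_Kurzweil_Integration.integral_combine) auto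
    ultimately show ?thesis by (metis add.commute add_left_imp_eq)
  qed
  show ?thesis
  proof (cases "h \<ge> 0")
    case True
    with * assms show ?thesis by blast
  next
    case False
    have "continuous_on UNIV (\<lambda>x. g (x + h))"
      by (intro continuous_on_compose2[OF cont] continuous_intros) auto
    moreover have "g (x + p + h) = g (x + h)" for x
      using per[of "x + h"] by (simp add: algebra_simps)
    ultimately show ?thesis
      using *[of "\<lambda>x. g (x + h)" "-h"] False by simp
  qed
qed

lemma cis_int_2pi: "cis (of_int n * (2 * pi)) = 1"
  by (metis cis_multiple_2pi Ints_of_int mult.commute)

lemma cis_periodic: "cis (- (of_int n * (x + 2 * pi))) = cis (- (of_int n * x))"
proof -
  have "- (of_int n * (x + 2 * pi)) = - (of_int n * x) + of_int (- n) * (2 * pi)"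
    by (simp add: algebra_simps)
  then show ?thesis
    by (metis cis_int_2pi cis_mult mult.right_neutral)
qed

text \<open>Serves two purposes: with \<open>h = c * t\<close> every mode of a travelling wave
  becomes a pure phase rotation, and with h a smaller period of f most coefficients are forced to
  vanish.\<close>

lemma fourier_coeff_shift:
  fixes f :: "real \<Rightarrow> real"
  assumes cont: "continuous_on UNIV f" and per: "\<And>x. f (x + 2*pi) = f x"
  shows "fourier_coeff (\<lambda>x. f (x + h)) n = cis (of_int n * h) * fourier_coeff f n"
proof -
  let ?g = "\<lambda>x. cis (- (of_int n * x)) * of_real (f x)"
  have c: "continuous_on UNIV (\<lambda>x. f (x + h))"
    by (intro continuous_on_compose2[OF cont] continuous_intros) auto
  have eq: "cis (- (of_int n * x)) * of_real (f (x + h)) = cis (of_int n * h) * ?g (x + h)" for x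
  proof -
    have "cis (- (of_int n * x)) = cis (of_int n * h) * cis (- (of_int n * (x + h)))"
      unfolding cis_mult by (simp add: algebra_simps)
    then show ?thesis by simp
  qed
  have "fourier_coeff (\<lambda>x. f (x + h)) n
      = integral {0..2*pi} (\<lambda>x. cis (of_int n * h) * ?g (x + h))"
    by (simp only: fourier_coeff_eq_integral[OF c] eq)
  also have "\<dots> = cis (of_int n * h) * integral {0..2*pi} (\<lambda>x. ?g (x + h))"
    by (rule integral_mult_right)
  also have "integral {0..2*pi} (\<lambda>x. ?g (x + h)) = integral {0..2*pi} ?g"
  proof (rule integral_periodic_shift)
    show "continuous_on UNIV ?g" by (intro continuous_intros cont)
    show "?g (x + 2*pi) = ?g x" for x by (simp only: cis_periodic per)
  qed simp
  finally show ?thesis using fourier_coeff_eq_integral[OF cont] by simp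
qed

text \<open>Shifting by \<open>2*pi / N\<close> fixes f but multiplies the n-th coefficient by a
  root of unity different from 1.\<close>

lemma fourier_coeff_eq_0:
  fixes f :: "real \<Rightarrow> real"
  assumes cont: "continuous_on UNIV f" and per: "\<And>x. f (x + 2*pi) = f x"
    and per': "\<And>x. f (x + 2*pi / of_int N) = f x" and "N > 0" "\<not> N dvd n"
  shows "fourier_coeff f n = 0"
proof -
  have "cis (of_int n * (2*pi / of_int N)) \<noteq> 1"
  proof
    assume "cis (of_int n * (2*pi / of_int N)) = 1"
    then have "cos (of_int n * (2*pi / of_int N)) = 1" by (metis cis.simps(1) one_complex.simps(1))
    then obtain k :: int where "of_int n * (2*pi / of_int N) = of_int k * 2 * pi"
      using cos_one_2pi_int by auto
    then have "(of_int n :: real) = of_int (k * N)" using \<open>N > 0\<close> by (simp add: field_simps)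
    then have "n = k * N" by (simp only: of_int_eq_iff)
    with \<open>\<not> N dvd n\<close> show False by simp
  qed
  then show ?thesis
    using fourier_coeff_shift[OF cont per, of "2*pi / of_int N" n] by (simp add: per')
qed

lemma cnj_fourier_coeff:
  fixes f :: "real \<Rightarrow> real"
  assumes cont: "continuous_on UNIV f"
  shows "cnj (fourier_coeff f n) = fourier_coeff f (- n)"
proof -
  have "((\<lambda>x. cnj (cis (- (of_int n * x)) * of_real (f x))) has_integral cnj (fourier_coeff f n)) {0..2*pi}"
    using fourier_coeff_has_integral[OF cont, of n]
    by (subst (asm) has_integral_cnj[symmetric]) (simp only: comp_def)
  then show ?thesis
    using fourier_coeff_has_integral[OF cont, of "-n"]
    by (simp add: cis_cnj has_integral_unique)
qed

lemma fourier_coeff_even: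
  fixes f :: "real \<Rightarrow> real"
  assumes cont: "continuous_on UNIV f" and per: "\<And>x. f (x + 2*pi) = f x" and even: "\<And>x. f (- x) = f x"
  shows "fourier_coeff f (- n) = fourier_coeff f n"
proof -
  let ?g = "\<lambda>x. cis (of_int n * x) * of_real (f x)"
  have "fourier_coeff f n = integral {0..2*pi} (\<lambda>x. ?g (- x))"
    using fourier_coeff_eq_integral[OF cont] by (simp add: even)
  also have "\<dots> = integral {-(2*pi)..0} ?g"
    using Henstock_Kurzweil_Integration.integral_reflect_real[of "2*pi" 0 "\<lambda>x. ?g (- x)"] by simp
  also have "\<dots> = integral {0..2*pi} (\<lambda>x. ?g (x + - (2*pi)))"
    using integral_shift_real_ivl[of "-(2*pi)" "-(2*pi)" 0 ?g] by simp
  also have "\<dots> = integral {0..2*pi} ?g"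
  proof (rule integral_periodic_shift)
    show "continuous_on UNIV ?g" by (intro continuous_intros cont)
    show "?g (x + 2*pi) = ?g x" for x using cis_periodic[of "-n" x] by (simp add: per)
  qed simp
  also have "\<dots> = fourier_coeff f (- n)"
    using fourier_coeff_eq_integral[OF cont, of "-n"] by simp
  finally show ?thesis by simp
qed

text \<open>Conjugation and reflection both send the coefficient at n to the one at -n, so it equals
  its own conjugate. This is what later allows the wave equation to be solved with real
  unknowns.\<close>

lemma fourier_coeff_even_real:
  fixes f :: "real \<Rightarrow> real"
  assumes "continuous_on UNIV f" "\<And>x. f (x + 2*pi) = f x" "\<And>x. f (- x) = f x"
  shows "fourier_coeff f n = of_real (Re (fourier_coeff f n))"
  using cnj_fourier_coeff[OF assms(1), of n] fourier_coeff_even[OF assms, of n]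
  by (simp add: complex_eq_iff)

lemma fourier_coeff_add:
  fixes f g :: "real \<Rightarrow> real"
  assumes "continuous_on UNIV f" "continuous_on UNIV g"
  shows "fourier_coeff (\<lambda>x. f x + g x) n = fourier_coeff f n + fourier_coeff g n"
  using has_integral_add[OF fourier_coeff_has_integral[OF assms(1)] fourier_coeff_has_integral[OF assms(2)], of n n]
    fourier_coeff_has_integral[OF continuous_on_add[OF assms], of n]
  by (simp add: algebra_simps has_integral_unique)

lemma fourier_coeff_cmult:
  "fourier_coeff (\<lambda>x. c * f x) n = of_real c * fourier_coeff f n"
proof -
  have "fourier_coeff (\<lambda>x. c * f x) n
      = (LINT x:{0..2*pi}|lborel. of_real c * (exp (- \<i> * of_int n * of_real x) * of_real (f x)))"
    unfolding fourier_coeff_def by (simp add: algebra_simps)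
  then show ?thesis unfolding fourier_coeff_def by simp
qed

lemma fourier_coeff_diff:
  fixes f g :: "real \<Rightarrow> real"
  assumes "continuous_on UNIV f" "continuous_on UNIV g"
  shows "fourier_coeff (\<lambda>x. f x - g x) n = fourier_coeff f n - fourier_coeff g n"
proof -
  have "continuous_on UNIV (\<lambda>x. (-1) * g x)" by (intro continuous_intros assms)
  from fourier_coeff_add[OF assms(1) this, of n] fourier_coeff_cmult[of "-1" g n] show ?thesis by simp
qed

lemma norm_fourier_coeff_le:
  fixes f :: "real \<Rightarrow> real"
  assumes "continuous_on UNIV f" "\<And>x. \<bar>f x\<bar> \<le> B"
  shows "cmod (fourier_coeff f n) \<le> 2 * pi * B"
proof -
  have "0 \<le> B" using assms(2)[of 0] by linarith
  have "cmod (fourier_coeff f n) \<le> B * Henstock_Kurzweil_Integration.content {0..2*pi}"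
    by (rule has_integral_bound_real[OF \<open>0 \<le> B\<close> finite.emptyI fourier_coeff_has_integral[OF assms(1)]])
      (use assms(2) in \<open>auto simp: norm_mult\<close>)
  then show ?thesis by (simp add: mult_ac)
qed

section \<open>Orthogonality of the exponentials\<close>

lemma integral_cis:
  "((\<lambda>x. cis (of_int j * x)) has_integral (if j = 0 then of_real (2*pi) else 0)) {0..2*pi}"
proof (cases "j = 0")
  case True
  then show ?thesis using has_integral_const_real[of "1::complex" 0 "2*pi"]
    by (simp add: scaleR_conv_of_real)
next
  case False
  have "((\<lambda>x. cis (of_int j * x)) has_integral
      (cis (of_int j * (2*pi)) / (\<i> * of_int j) - cis (of_int j * 0) / (\<i> * of_int j))) {0..2*pi}"
  proof (rule fundamental_theorem_of_calculus)
    fix x :: real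
    have "((\<lambda>x. cis (of_int j * x)) has_vector_derivative of_int j *\<^sub>R (\<i> * cis (of_int j * x))) (at x within {0..2*pi})"
      unfolding has_vector_derivative_complex_iff by (auto intro!: derivative_eq_intros)
    from has_vector_derivative_divide[OF this, of "\<i> * of_int j"] False
    show "((\<lambda>x. cis (of_int j * x) / (\<i> * of_int j)) has_vector_derivative cis (of_int j * x)) (at x within {0..2*pi})"
      by (simp add: scaleR_conv_of_real field_simps)
  qed simp
  then show ?thesis using False by (simp add: cis_int_2pi)
qed

lemma fourier_coeff_cos:
  "fourier_coeff (\<lambda>x. cos (of_int m * x)) n
     = (if n = m then of_real pi else 0) + (if n = - m then of_real pi else 0)"
proof -
  have c: "continuous_on UNIV (\<lambda>x::real. cos (of_int m * x))" by (intro continuous_intros)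
  have int: "((\<lambda>x. (cis (of_int (m - n) * x) + cis (of_int (- m - n) * x)) / 2) has_integral
      ((if m - n = 0 then of_real (2*pi) else 0) + (if - m - n = 0 then of_real (2*pi) else 0)) / 2) {0..2*pi}"
    by (intro has_integral_divide has_integral_add integral_cis)
  have eq: "(cis (of_int (m - n) * x) + cis (of_int (- m - n) * x)) / 2
     = cis (- (of_int n * x)) * of_real (cos (of_int m * x))" for x
  proof -
    have "cis (of_int (m - n) * x) = cis (- (of_int n * x)) * cis (of_int m * x)"
      "cis (of_int (- m - n) * x) = cis (- (of_int n * x)) * cis (- (of_int m * x))"
      by (simp_all add: cis_mult algebra_simps)
    moreover have "cis (of_int m * x) + cis (- (of_int m * x)) = 2 * of_real (cos (of_int m * x))"
      by (simp add: complex_eq_iff)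
    ultimately show ?thesis by (simp only: flip: distrib_left) simp
  qed
  from int[unfolded eq] have "fourier_coeff (\<lambda>x. cos (of_int m * x)) n =
      ((if m - n = 0 then of_real (2*pi) else 0) + (if - m - n = 0 then of_real (2*pi) else 0)) / 2"
    by (rule has_integral_unique[OF fourier_coeff_has_integral[OF c]])
  then show ?thesis by auto
qed

section \<open>Absolutely convergent cosine series\<close>

definition cos_series :: "int \<Rightarrow> (nat \<Rightarrow> real) \<Rightarrow> real \<Rightarrow> real" where
  "cos_series N u x = (\<Sum>k. u k * cos (of_int (int k * N) * x))"

lemma cos_series_uniform:
  assumes "summable (\<lambda>k. \<bar>u k\<bar>)"
  shows "uniform_limit UNIV (\<lambda>m x. \<Sum>k<m. u k * cos (of_int (int k * N) * x)) (cos_series N u) sequentially"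
  unfolding cos_series_def
  by (rule Weierstrass_m_test[OF _ assms]) (simp add: abs_mult mult_left_le)

lemma cos_series_sums:
  assumes "summable (\<lambda>k. \<bar>u k\<bar>)"
  shows "(\<lambda>k. u k * cos (of_int (int k * N) * x)) sums cos_series N u x"
  unfolding cos_series_def
  by (intro summable_sums summable_comparison_test'[OF assms]) (simp add: abs_mult mult_left_le)

lemma continuous_cos_series:
  assumes "summable (\<lambda>k. \<bar>u k\<bar>)"
  shows "continuous_on UNIV (cos_series N u)"
  by (rule uniform_limit_theorem[OF _ cos_series_uniform[OF assms, of N]])
    (auto intro!: always_eventually continuous_intros)

lemma cos_series_even: "cos_series N u (- x) = cos_series N u x"
  by (simp add: cos_series_def)

lemma cos_series_periodic:
  assumes "N > 0"
  shows "cos_series N u (x + 2*pi / of_int N) = cos_series N u x"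
proof -
  have "cos (of_int (int k * N) * (x + 2*pi / of_int N)) = cos (of_int (int k * N) * x)" for k
  proof -
    have "of_int (int k * N) * (x + 2*pi / of_int N) = of_int (int k * N) * x + of_int (int k) * (2 * pi)"
      using assms by (simp add: field_simps)
    moreover have "cos (of_int (int k) * (2 * pi)) = 1" "sin (of_int (int k) * (2 * pi)) = 0"
      by (metis cis.simps cis_int_2pi one_complex.simps)+
    ultimately show ?thesis by (simp only: cos_add)
  qed
  then show ?thesis by (simp add: cos_series_def)
qed

lemma cos_series_2pi: "cos_series N u (x + 2*pi) = cos_series N u x"
proof -
  have "cos (of_int (int k * N) * (x + 2*pi)) = cos (of_int (int k * N) * x)" for k
    using cis_periodic[of "- (int k * N)" x] by (metis cis.simps(1) minus_minus mult_minus_left of_int_minus)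
  then show ?thesis by (simp add: cos_series_def)
qed

text \<open>Partial sums have the stated coefficient by orthogonality once they contain the one
  matching index, and uniform convergence carries it to the limit. The proviso at
  \<open>n = 0\<close> reflects that the frequencies m and -m coincide there, so a constant term
  would contribute \<open>2 * pi * u 0\<close> instead of \<open>pi * u 0\<close>.\<close>

lemma fourier_coeff_cos_series:
  assumes "summable (\<lambda>k. \<bar>u k\<bar>)" "N > 0" "n = 0 \<Longrightarrow> u 0 = 0"
  shows "fourier_coeff (cos_series N u) n = (if N dvd n then of_real (pi * u (nat (\<bar>n\<bar> div N))) else 0)"
proof (cases "N dvd n")
  case False
  then show ?thesis
    using fourier_coeff_eq_0[OF continuous_cos_series[OF assms(1)] cos_series_2pi cos_series_periodic] assms by auto
next
  case True
  define k0 where "k0 = nat (\<bar>n\<bar> div N)"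
  have k0: "int k0 * N = \<bar>n\<bar>" using True assms by (simp add: k0_def pos_imp_zdiv_nonneg_iff)
  let ?f = "\<lambda>m x. \<Sum>k<m. u k * cos (of_int (int k * N) * x)"
  have cf: "continuous_on UNIV (?f m)" for m by (intro continuous_intros)
  have fin: "fourier_coeff (?f m) n = (\<Sum>k<m. if k = k0 then of_real (pi * u k0) else 0)" for m
  proof (induction m)
    case 0
    then show ?case by (simp add: fourier_coeff_def)
  next
    case (Suc m)
    have "fourier_coeff (\<lambda>x. u m * cos (of_int (int m * N) * x)) n
        = of_real (u m) * ((if n = int m * N then of_real pi else 0) + (if n = - (int m * N) then of_real pi else 0))"
      by (simp only: fourier_coeff_cmult fourier_coeff_cos)
    also have "\<dots> = (if m = k0 then of_real (pi * u k0) else 0)"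
    proof -
      have "m = k0 \<longleftrightarrow> int m * N = \<bar>n\<bar>" using k0 assms by (metis mult_right_cancel nat_int not_less_iff_gr_or_eq)
      moreover have "(int m * N = \<bar>n\<bar>) \<longleftrightarrow> n = int m * N \<or> n = - (int m * N)"
        using assms(2) by (auto simp: abs_if zero_less_mult_iff mult_less_0_iff)
      moreover have "u m = 0" if "n = int m * N" "n = - (int m * N)"
        using that assms(2,3) by auto
      ultimately show ?thesis by auto
    qed
    finally have 1: "fourier_coeff (\<lambda>x. u m * cos (of_int (int m * N) * x)) n
        = (if m = k0 then of_real (pi * u k0) else 0)" .
    have "fourier_coeff (?f (Suc m)) n = fourier_coeff (?f m) n + fourier_coeff (\<lambda>x. u m * cos (of_int (int m * N) * x)) n"
      unfolding sum.lessThan_Suc by (rule fourier_coeff_add[OF cf]) (intro continuous_intros)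
    then show ?case using Suc 1 by simp
  qed
  have "uniform_limit {0..2*pi} (\<lambda>m x. cis (- (of_int n * x)) * of_real (?f m x))
      (\<lambda>x. cis (- (of_int n * x)) * of_real (cos_series N u x)) sequentially"
  proof (rule uniform_limitI)
    fix e :: real assume "e > 0"
    from uniform_limitD[OF cos_series_uniform[OF assms(1), of N] this]
    show "\<forall>\<^sub>F m in sequentially. \<forall>x\<in>{0..2*pi}. dist (cis (- (of_int n * x)) * of_real (?f m x))
        (cis (- (of_int n * x)) * of_real (cos_series N u x)) < e"
    proof eventually_elim
      case (elim m)
      have "dist (cis (- (of_int n * x)) * complex_of_real (?f m x))
          (cis (- (of_int n * x)) * of_real (cos_series N u x)) = dist (?f m x) (cos_series N u x)" for x
        unfolding dist_norm by (simp add: norm_mult flip: right_diff_distrib of_real_diff of_real_sum of_real_mult)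
      with elim show ?case by simp
    qed
  qed
  then obtain I J where
    I: "\<And>m. ((\<lambda>x. cis (- (of_int n * x)) * of_real (?f m x)) has_integral I m) {0..2*pi}" and
    J: "((\<lambda>x. cis (- (of_int n * x)) * of_real (cos_series N u x)) has_integral J) {0..2*pi}" and
    lim: "I \<longlonglongrightarrow> J"
    by (rule uniform_limit_integral) (auto intro!: continuous_intros)
  have "I = (\<lambda>m. fourier_coeff (?f m) n)"
    using has_integral_unique[OF I fourier_coeff_has_integral[OF cf]] by blast
  then have "(\<lambda>m. \<Sum>k<m. if k = k0 then of_real (pi * u k0) else 0) \<longlonglongrightarrow> J"
    using lim by (simp only: fin)
  then have "(\<lambda>k. if k = k0 then complex_of_real (pi * u k0) else 0) sums J" by (simp add: sums_def)
  moreover have "(\<lambda>k. if k = k0 then complex_of_real (pi * u k0) else 0) sums of_real (pi * u k0)"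
    by (rule sums_single)
  ultimately have "J = of_real (pi * u k0)" by (rule sums_unique2)
  moreover have "J = fourier_coeff (cos_series N u) n"
    using J fourier_coeff_has_integral[OF continuous_cos_series[OF assms(1)]] by (rule has_integral_unique)
  ultimately show ?thesis using True k0_def by simp
qed

section \<open>Sobolev norms and travelling waves\<close>


lemma summable_on_inverse_1_square: "(\<lambda>n::int. 1 / (1 + (of_int n)\<^sup>2) :: real) summable_on UNIV"
proof -
  let ?g = "\<lambda>n::int. 1 / (1 + (of_int n)\<^sup>2) :: real"
  have s: "summable (\<lambda>n::nat. 1 / (1 + (real n)\<^sup>2))"
    by (rule summable_comparison_test'[OF inverse_power_summable[of 2, where ?'a = real], of 1])
      (auto simp: divide_simps add_pos_nonneg)
  have "(?g \<circ> int) summable_on UNIV"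
    using s by (intro norm_summable_imp_summable_on) (simp add: comp_def)
  then have 1: "?g summable_on range int" by (subst summable_on_reindex) auto
  have s': "summable (\<lambda>n. 1 / (1 + (real (Suc n))\<^sup>2))" using s by (subst summable_Suc_iff)
  have "(?g \<circ> (\<lambda>n. - int (Suc n))) summable_on UNIV"
    by (rule norm_summable_imp_summable_on, rule summable_cong[THEN iffD1, OF _ s'])
      (simp add: comp_def power2_commute algebra_simps power2_eq_square)
  then have 2: "?g summable_on range (\<lambda>n. - int (Suc n))" by (subst summable_on_reindex) (auto intro: injI)
  have "?g summable_on (range int \<union> range (\<lambda>n. - int (Suc n)))"
    by (rule summable_on_Un_disjoint[OF 1 2]) auto
  moreover have "range int \<union> range (\<lambda>n. - int (Suc n)) = UNIV"
  proof -
    have "z \<in> range int \<union> range (\<lambda>n. - int (Suc n))" for z :: int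
      by (cases z rule: int_cases) auto
    then show ?thesis by blast
  qed
  ultimately show ?thesis by simp
qed

lemma hs_weight_nonneg: "hs_weight s f n \<ge> 0"
  by (simp add: hs_weight_def)

text \<open>Raising the exponent to 1 leaves a polynomial weight, so that summability reduces to
  that of \<open>1 / (1 + n^2)\<close>.\<close>

lemma hs_weight_le:
  assumes "s \<le> 1" and "cmod (fourier_coeff f n) \<le> b"
  shows "hs_weight s f n \<le> (1 + (of_int n)\<^sup>2) * b\<^sup>2"
proof -
  have "(1 + (of_int n)\<^sup>2 :: real) powr s \<le> (1 + (of_int n)\<^sup>2) powr 1"
    by (rule powr_mono) (use assms(1) in auto)
  then show ?thesis
    unfolding hs_weight_def using assms(2)
    by (intro mult_mono power_mono) (auto simp: add_nonneg_nonneg)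
qed

lemma hs_norm_le:
  assumes "\<And>n. hs_weight s f n \<le> g n" and "g summable_on UNIV"
  shows "hs_weight s f summable_on UNIV" and "(hs_norm s f)\<^sup>2 \<le> 1 / (2*pi) * infsum g UNIV"
proof -
  show *: "hs_weight s f summable_on UNIV"
    by (rule summable_on_comparison_test[OF assms(2)]) (auto simp: assms(1) hs_weight_nonneg)
  have "infsum (hs_weight s f) UNIV \<le> infsum g UNIV"
    by (rule infsum_mono[OF * assms(2)]) (rule assms(1))
  moreover have "infsum (hs_weight s f) UNIV \<ge> 0"
    by (rule infsum_nonneg) (rule hs_weight_nonneg)
  ultimately show "(hs_norm s f)\<^sup>2 \<le> 1 / (2*pi) * infsum g UNIV"
    unfolding hs_norm_def by (simp add: divide_right_mono)
qed

lemma hs_norm_ge: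
  assumes "hs_weight s f summable_on UNIV"
  shows "1 / (2*pi) * hs_weight s f n \<le> (hs_norm s f)\<^sup>2"
proof -
  have "infsum (hs_weight s f) {n} \<le> infsum (hs_weight s f) UNIV"
    by (rule infsum_mono2) (use assms hs_weight_nonneg in auto)
  moreover have "hs_weight s f n \<ge> 0" by (rule hs_weight_nonneg)
  ultimately show ?thesis unfolding hs_norm_def by (simp add: divide_right_mono)
qed

lemma hs_norm_nonneg: "hs_norm s f \<ge> 0"
  unfolding hs_norm_def by (intro real_sqrt_ge_zero mult_nonneg_nonneg infsum_nonneg hs_weight_nonneg) auto

section \<open>Travelling waves and the Duhamel formula\<close>

lemma norm_cis_diff_le: "cmod (cis a - cis b) \<le> \<bar>a - b\<bar>"
proof -
  have "cis a - cis b = cis b * (cis (a - b) - 1)"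
    by (simp add: algebra_simps cis_mult)
  then have "cmod (cis a - cis b) = cmod (exp (\<i> * of_real (a - b)) - 1)"
    by (simp add: norm_mult cis_conv_exp)
  also have "\<dots> = 2 * \<bar>sin ((a - b) / 2)\<bar>"
    using dist_exp_i_1[of "a - b"] by simp
  also have "\<dots> \<le> \<bar>a - b\<bar>" using abs_sin_x_le_abs_x[of "(a - b) / 2"] by simp
  finally show ?thesis .
qed

text \<open>\<open>wave\<close> is the Fourier transform of the ordinary differential equation for
  the profile. The power in \<open>decay\<close> pays for the weight \<open>1 + n^2\<close> and also
  for the factor n that a time difference costs in mode n, which gives continuity in time with a
  Lipschitz bound.\<close>

lemma mkaw_solution_travelling_wave:
  fixes \<phi> :: "real \<Rightarrow> real"
  assumes "s \<le> 1" and cont: "continuous_on UNIV \<phi>" and per: "\<And>x. \<phi> (x + 2*pi) = \<phi> x"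
    and decay: "\<And>n. cmod (fourier_coeff \<phi> n) \<le> C / (1 + (of_int n)\<^sup>2)\<^sup>2"
    and wave: "\<And>n. of_real (of_int n * c - mk_phase \<beta> \<gamma> n) * fourier_coeff \<phi> n
        = of_real (\<mu> / 3) * of_int n * fourier_coeff (\<lambda>x. \<phi> x ^ 3) n"
  shows "mkaw_solution \<beta> \<gamma> \<mu> s T (\<lambda>t x. \<phi> (x + c * t))"
proof -
  let ?v = "\<lambda>t x. \<phi> (x + c * t)"
  let ?q = "\<lambda>n::int. 1 + (of_int n)\<^sup>2 :: real"
  have q1: "?q n \<ge> 1" for n by simp
  have cv: "continuous_on A (?v t)" for t A
    by (intro continuous_on_compose2[OF cont] continuous_intros) auto
  have fv: "fourier_coeff (?v t) n = cis (of_int n * (c * t)) * fourier_coeff \<phi> n" for t n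
    by (rule fourier_coeff_shift[OF cont per])
  have f3: "fourier_coeff (\<lambda>x. ?v t x ^ 3) n = cis (of_int n * (c * t)) * fourier_coeff (\<lambda>x. \<phi> x ^ 3) n" for t n
    by (rule fourier_coeff_shift) (auto intro!: continuous_intros cont simp: per)
  have C0: "C \<ge> 0" using order_trans[OF norm_ge_zero decay[of 0]] by simp
  have "in_Hs s (?v t)" for t
    unfolding in_Hs_def
  proof (intro conjI allI)
    show "\<phi> (x + 2 * pi + c * t) = \<phi> (x + c * t)" for x
      using per[of "x + c * t"] by (simp add: algebra_simps)
    show "set_borel_measurable lborel {0..2 * pi} (?v t)"
      using borel_integrable_atLeastAtMost'[OF cv, of 0 "2*pi" t]
      by (simp add: set_integrable_def set_borel_measurable_def)
    show "set_integrable lborel {0..2 * pi} (\<lambda>x. (\<phi> (x + c * t))\<^sup>2)"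
      by (intro borel_integrable_atLeastAtMost' continuous_intros cv)
    have "hs_weight s (?v t) n \<le> C\<^sup>2 * (1 / ?q n)" for n
    proof -
      have "hs_weight s (?v t) n \<le> ?q n * (C / (?q n)\<^sup>2)\<^sup>2"
        by (rule hs_weight_le[OF \<open>s \<le> 1\<close>]) (simp add: fv norm_mult decay)
      also have "\<dots> = C\<^sup>2 * (1 / ?q n) * (1 / ?q n)\<^sup>2"
      proof -
        have "q * (C / q\<^sup>2)\<^sup>2 = C\<^sup>2 * (1 / q) * (1 / q)\<^sup>2" if "q \<ge> 1" for q :: real
          using that by (simp add: power2_eq_square field_simps)
        then show ?thesis using q1 by blast
      qed
      also have "\<dots> \<le> C\<^sup>2 * (1 / ?q n) * 1"
        using q1[of n] by (intro mult_left_mono power_le_one) (auto simp: divide_le_eq_1_pos add_pos_nonneg)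
      finally show ?thesis by simp
    qed
    then show "hs_weight s (?v t) summable_on UNIV"
      by (rule hs_norm_le(1)) (intro summable_on_cmult_right summable_on_inverse_1_square)
  qed
  moreover have "((\<lambda>t. hs_norm s (\<lambda>x. ?v t x - ?v t0 x)) \<longlongrightarrow> 0) (at t0 within {0..T})" for t0
  proof -
    define S where "S = infsum (\<lambda>n. 1 / ?q n) UNIV"
    define K where "K = sqrt (1 / (2*pi) * (C\<^sup>2 * c\<^sup>2 * S))"
    have S0: "S \<ge> 0" unfolding S_def by (rule infsum_nonneg) simp
    have le: "hs_norm s (\<lambda>x. ?v t x - ?v t0 x) \<le> K * \<bar>t - t0\<bar>" for t
    proof -
      have "hs_weight s (\<lambda>x. ?v t x - ?v t0 x) n \<le> C\<^sup>2 * c\<^sup>2 * (t - t0)\<^sup>2 * (1 / ?q n)" for n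
      proof -
        have "cmod (fourier_coeff (\<lambda>x. ?v t x - ?v t0 x) n)
            = cmod (cis (of_int n * (c * t)) - cis (of_int n * (c * t0))) * cmod (fourier_coeff \<phi> n)"
          by (simp add: fourier_coeff_diff cv fv norm_mult flip: left_diff_distrib)
        also have "\<dots> \<le> \<bar>of_int n * (c * t) - of_int n * (c * t0)\<bar> * (C / (?q n)\<^sup>2)"
          by (intro mult_mono norm_cis_diff_le decay) auto
        finally have "hs_weight s (\<lambda>x. ?v t x - ?v t0 x) n
            \<le> ?q n * (\<bar>of_int n * (c * t) - of_int n * (c * t0)\<bar> * (C / (?q n)\<^sup>2))\<^sup>2"
          by (rule hs_weight_le[OF \<open>s \<le> 1\<close>])
        also have "\<dots> = ?q n * (C\<^sup>2 * c\<^sup>2 * (t - t0)\<^sup>2 * (of_int n)\<^sup>2 * (1 / (?q n)^4))"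
        proof -
          have "of_int n * (c * t) - of_int n * (c * t0) = of_int n * c * (t - t0)" by (simp add: algebra_simps)
          then show ?thesis
            by (simp only: power_mult_distrib power2_abs power_divide) (simp add: mult_ac)
        qed
        also have "\<dots> = C\<^sup>2 * c\<^sup>2 * (t - t0)\<^sup>2 * (1 / ?q n) * ((of_int n)\<^sup>2 / (?q n) * (1 / ?q n))"
        proof -
          have "q * (a * m * (1 / q^4)) = a * (1 / q) * (m / q * (1 / q))" if "q \<ge> 1" for q a m :: real
            using that by (simp add: power4_eq_xxxx field_simps)
          then show ?thesis using q1 by blast
        qed
        also have "\<dots> \<le> C\<^sup>2 * c\<^sup>2 * (t - t0)\<^sup>2 * (1 / ?q n) * (1 * 1)"
          using q1[of n] by (intro mult_mono mult_left_mono) (auto simp: divide_le_eq_1_pos add_pos_nonneg)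
        finally show ?thesis by simp
      qed
      from hs_norm_le(2)[OF this summable_on_cmult_right[OF summable_on_inverse_1_square]]
      have "(hs_norm s (\<lambda>x. ?v t x - ?v t0 x))\<^sup>2 \<le> 1 / (2*pi) * (C\<^sup>2 * c\<^sup>2 * (t - t0)\<^sup>2 * S)"
        by (simp only: S_def infsum_cmult_right')
      also have "\<dots> = (K * \<bar>t - t0\<bar>)\<^sup>2"
        using S0 by (simp add: K_def power_mult_distrib)
      finally show ?thesis
        by (rule power2_le_imp_le) (use S0 in \<open>simp add: K_def\<close>)
    qed
    have lim: "((\<lambda>t. K * \<bar>t - t0\<bar>) \<longlongrightarrow> 0) (at t0 within {0..T})"
      by (auto intro!: tendsto_eq_intros)
    show ?thesis
    proof (rule tendsto_sandwich[OF _ _ tendsto_const lim])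
      show "\<forall>\<^sub>F t in at t0 within {0..T}. 0 \<le> hs_norm s (\<lambda>x. ?v t x - ?v t0 x)"
        by (rule always_eventually) (rule allI, rule hs_norm_nonneg)
      show "\<forall>\<^sub>F t in at t0 within {0..T}. hs_norm s (\<lambda>x. ?v t x - ?v t0 x) \<le> K * \<bar>t - t0\<bar>"
        by (rule always_eventually) (rule allI, rule le)
    qed
  qed
  moreover have "set_integrable lborel {0..2*pi} (\<lambda>x. (?v \<tau> x)^3)" for \<tau>
    by (intro borel_integrable_atLeastAtMost' continuous_intros cv)
  moreover have "set_integrable lborel {0..t} (duhamel_integrand \<beta> \<gamma> ?v t n)
    \<and> fourier_coeff (?v t) n =
          exp (\<i> * of_real (t * mk_phase \<beta> \<gamma> n)) * fourier_coeff (?v 0) n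
          + of_real (\<mu> / 3) * (LINT \<tau>:{0..t}|lborel. duhamel_integrand \<beta> \<gamma> ?v t n \<tau>)"
    if "t \<ge> 0" for t n
  proof -
    let ?p = "mk_phase \<beta> \<gamma> n"
    let ?D = "duhamel_integrand \<beta> \<gamma> ?v t n"
    \<comment> \<open>\<open>?F\<close> joins the freely evolved datum at \<open>\<tau> = 0\<close>
      to the wave at \<open>\<tau> = t\<close>. By \<open>wave\<close> its derivative is
      \<open>\<mu> / 3\<close> times the Duhamel integrand, so the Duhamel formula becomes the
      fundamental theorem of calculus.\<close>
    let ?F = "\<lambda>\<tau>. cis ((t - \<tau>) * ?p + of_int n * (c * \<tau>)) * fourier_coeff \<phi> n"
    have D: "?D \<tau> = cis ((t - \<tau>) * ?p + of_int n * (c * \<tau>)) * (\<i> * of_int n * fourier_coeff (\<lambda>x. \<phi> x ^ 3) n)" for \<tau>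
      unfolding duhamel_integrand_def f3 cis_conv_exp[symmetric] cis_mult[symmetric]
      by (simp only: mult_ac)
    have si: "set_integrable lborel {0..t} ?D"
      unfolding D by (intro borel_integrable_atLeastAtMost' continuous_intros)
    have "((\<lambda>\<tau>. of_real (\<mu> / 3) * ?D \<tau>) has_integral (?F t - ?F 0)) {0..t}"
    proof (rule fundamental_theorem_of_calculus[OF \<open>t \<ge> 0\<close>])
      fix \<tau> :: real
      have "(?F has_vector_derivative ((- ?p + of_int n * c) *\<^sub>R (\<i> * cis ((t - \<tau>) * ?p + of_int n * (c * \<tau>)))) * fourier_coeff \<phi> n)
          (at \<tau> within {0..t})"
        by (intro has_vector_derivative_mult_left)
          (auto simp: has_vector_derivative_def intro!: derivative_eq_intros simp: algebra_simps)
      moreover have "((- ?p + of_int n * c) *\<^sub>R (\<i> * cis ((t - \<tau>) * ?p + of_int n * (c * \<tau>)))) * fourier_coeff \<phi> n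
        = \<i> * cis ((t - \<tau>) * ?p + of_int n * (c * \<tau>)) * (of_real (of_int n * c - ?p) * fourier_coeff \<phi> n)"
        by (simp add: scaleR_conv_of_real algebra_simps)
      moreover have "\<dots> = of_real (\<mu> / 3) * ?D \<tau>"
        unfolding wave D by (simp add: mult_ac)
      ultimately show "(?F has_vector_derivative of_real (\<mu> / 3) * ?D \<tau>) (at \<tau> within {0..t})"
        by (simp only:)
    qed
    moreover have "((\<lambda>\<tau>. of_real (\<mu> / 3) * ?D \<tau>) has_integral (of_real (\<mu> / 3) * (LINT \<tau>:{0..t}|lborel. ?D \<tau>))) {0..t}"
      unfolding set_borel_integral_eq_integral(2)[OF si]
      by (intro has_integral_mult_right integrable_integral set_borel_integral_eq_integral(1)[OF si])
    ultimately have "?F t - ?F 0 = of_real (\<mu> / 3) * (LINT \<tau>:{0..t}|lborel. ?D \<tau>)"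
      by (rule has_integral_unique)
    then have "?F t = ?F 0 + of_real (\<mu> / 3) * (LINT \<tau>:{0..t}|lborel. ?D \<tau>)"
      by (metis add.commute diff_add_cancel)
    with si show ?thesis by (simp add: fv cis_conv_exp)
  qed
  ultimately show ?thesis unfolding mkaw_solution_def by auto
qed

section \<open>The cubic interaction of a wave profile\<close>


text \<open>The contraction principle on the unit ball of bounded sequences, with limits taken
  entrywise. The rate \<open>2 * c ^ n\<close> is the same for all entries, and so
  \<open>lipschitz\<close>, which asks for a uniform d, also applies to the limit against an
  iterate.\<close>

lemma bounded_sequence_fixpoint:
  fixes F :: "(nat \<Rightarrow> real) \<Rightarrow> nat \<Rightarrow> real"
  assumes bound: "\<And>x k. (\<And>j. \<bar>x j\<bar> \<le> 1) \<Longrightarrow> \<bar>F x k\<bar> \<le> 1"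
    and lipschitz: "\<And>x y d k. (\<And>j. \<bar>x j\<bar> \<le> 1) \<Longrightarrow> (\<And>j. \<bar>y j\<bar> \<le> 1) \<Longrightarrow> (\<And>j. \<bar>x j - y j\<bar> \<le> d)
      \<Longrightarrow> \<bar>F x k - F y k\<bar> \<le> c * d"
    and c: "0 \<le> c" "c < 1"
  obtains x where "\<And>j. \<bar>x j\<bar> \<le> 1" "F x = x"
proof -
  define X where "X n = (F ^^ n) (\<lambda>_. 0)" for n
  have XS: "X (Suc n) = F (X n)" for n by (simp add: X_def)
  have X1: "\<bar>X n j\<bar> \<le> 1" for n j
    by (induction n arbitrary: j) (auto simp: XS intro: bound, simp add: X_def)
  have Xd: "\<bar>X (n + m) j - X n j\<bar> \<le> 2 * c ^ n" for n m j
  proof (induction n arbitrary: j)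
    case 0
    show ?case using X1[of m j] X1[of 0 j] by simp
  next
    case (Suc n)
    show ?case
      using lipschitz[OF X1 X1 Suc.IH] by (simp add: XS mult_ac)
  qed
  have c0: "(\<lambda>n. C * c ^ n) \<longlonglongrightarrow> 0" for C
    using c by (intro tendsto_mult_right_zero LIMSEQ_realpow_zero)
  have "\<exists>L. (\<lambda>n. X n j) \<longlonglongrightarrow> L" for j
  proof -
    have "Cauchy (\<lambda>n. X n j)"
    proof (rule metric_CauchyI)
      fix e :: real assume "e > 0"
      then obtain M where M: "4 * c ^ M < e"
        using order_tendstoD(2)[OF c0[of 4]] by (auto simp: eventually_sequentially)
      have "dist (X m j) (X n j) < e" if "m \<ge> M" "n \<ge> M" for m n
        using Xd[of M "m - M" j] Xd[of M "n - M" j] that M by (simp add: dist_real_def)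
      then show "\<exists>M. \<forall>m\<ge>M. \<forall>n\<ge>M. dist (X m j) (X n j) < e" by blast
    qed
    then show ?thesis by (simp add: Cauchy_convergent_iff convergent_def)
  qed
  then obtain L where L: "\<And>j. (\<lambda>n. X n j) \<longlonglongrightarrow> L j" by metis
  have L1: "\<bar>L j\<bar> \<le> 1" for j
    by (rule LIMSEQ_le_const2[OF tendsto_rabs[OF L]]) (use X1 in auto)
  have Ld: "\<bar>L j - X n j\<bar> \<le> 2 * c ^ n" for j n
  proof (rule LIMSEQ_le_const2)
    show "(\<lambda>m. \<bar>X (n + m) j - X n j\<bar>) \<longlonglongrightarrow> \<bar>L j - X n j\<bar>"
      using LIMSEQ_ignore_initial_segment[OF L[of j], of n]
      by (intro tendsto_intros) (simp add: add.commute)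
  qed (use Xd in auto)
  have "(\<lambda>n. X (Suc n) k) \<longlonglongrightarrow> F L k" for k
  proof (rule Lim_null_comparison[where g = "\<lambda>n. (c * 2) * c ^ n", THEN Lim_null[THEN iffD2]])
    show "\<forall>\<^sub>F n in sequentially. norm (X (Suc n) k - F L k) \<le> (c * 2) * c ^ n"
      using lipschitz[OF L1 X1 Ld] by (intro always_eventually) (simp add: XS abs_minus_commute mult_ac)
  qed (rule c0)
  then have "F L = L"
    using LIMSEQ_unique[OF _ LIMSEQ_Suc[OF L]] by blast
  with L1 show thesis by (rule that)
qed

text \<open>The unknown \<open>x\<close> is the sequence of cosine coefficients multiplied by \<open>k\<^sup>4\<close>, so that the smoothing
  of the linear part becomes boundedness of \<open>x\<close>; the first harmonic is normalised to 1 and the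
  entries \<open>x 0\<close> and \<open>x 1\<close> play no role.\<close>

definition profile_coeff :: "(nat \<Rightarrow> real) \<Rightarrow> nat \<Rightarrow> real" where
  "profile_coeff x k = (if k = 0 then 0 else if k = 1 then 1 else x k / real k ^ 4)"

definition profile :: "int \<Rightarrow> (nat \<Rightarrow> real) \<Rightarrow> real \<Rightarrow> real" where
  "profile N x = cos_series N (profile_coeff x)"

text \<open>For \<open>k >= 1\<close> the coefficient of \<open>cos (k N y)\<close> at
  \<open>k N\<close> is pi, so the division yields the cosine coefficient of the cubed profile at
  harmonic k. The cube of an even profile has real coefficients, so \<open>Re\<close> loses
  nothing.\<close>

definition cubic_coeff :: "int \<Rightarrow> (nat \<Rightarrow> real) \<Rightarrow> nat \<Rightarrow> real" where
  "cubic_coeff N x k = Re (fourier_coeff (\<lambda>y. profile N x y ^ 3) (int k * N)) / pi"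

text \<open>Telescoping against \<open>1 / (t * (t + 1))\<close>. The crude bound 1 keeps profiles
  within distance 1 of the pure cosine, hence in [-2,2], and makes them depend on the sequence with
  Lipschitz constant 1.\<close>

lemma sum_inverse_fourth:
  defines "q \<equiv> \<lambda>k::nat. if k < 2 then 0 else 1 / real k ^ 4"
  shows "summable q" "suminf q \<le> 1"
proof -
  have step: "q (Suc (Suc m)) \<le> 1 / real (Suc m) - 1 / real (Suc (Suc m))" for m
  proof -
    define t where "t = real (Suc m)"
    have t: "t \<ge> 1" by (simp add: t_def)
    have "t * (t + 1) \<le> (t + 1) * (t + 1)" using t by (intro mult_right_mono) auto
    also have "\<dots> \<le> (t + 1) ^ 4" using t power_increasing[of 2 4 "t + 1"] by (simp add: power2_eq_square)
    finally have "1 / (t + 1) ^ 4 \<le> 1 / (t * (t + 1))" using t by (intro divide_left_mono) auto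
    also have "\<dots> = 1 / t - 1 / (t + 1)" using t by (simp add: field_simps)
    finally show ?thesis by (simp add: q_def t_def add.commute)
  qed
  have "(\<Sum>k<Suc (Suc m). q k) \<le> 1 - 1 / real (Suc m)" for m
  proof (induction m)
    case 0
    then show ?case by (simp add: q_def)
  next
    case (Suc m)
    then show ?case using step[of m] by simp
  qed
  moreover have nonneg: "q k \<ge> 0" for k by (simp add: q_def)
  ultimately have le: "(\<Sum>k<m. q k) \<le> 1" for m
  proof -
    have "(\<Sum>k<m. q k) \<le> (\<Sum>k<Suc (Suc m). q k)" using nonneg by (intro sum_mono2) auto
    also have "\<dots> \<le> 1 - 1 / real (Suc m)" by fact
    also have "\<dots> \<le> 1" by simp
    finally show ?thesis .
  qed
  show "summable q" by (rule summableI_nonneg_bounded[OF nonneg le])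
  then show "suminf q \<le> 1" by (rule suminf_le_const[OF _ le])
qed

lemma summable_profile_coeff:
  assumes "\<And>j. \<bar>x j\<bar> \<le> 1"
  shows "summable (\<lambda>k. \<bar>profile_coeff x k\<bar>)"
proof (rule summable_comparison_test'[OF sum_inverse_fourth(1), of 2])
  show "norm \<bar>profile_coeff x k\<bar> \<le> (if k < 2 then 0 else 1 / real k ^ 4)" if "k \<ge> 2" for k
    using that assms[of k] by (auto simp: profile_coeff_def divide_right_mono)
qed

lemma profile_0: "profile N (\<lambda>_. 0) y = cos (of_int N * y)"
proof -
  have "(\<lambda>k. profile_coeff (\<lambda>_. 0) k * cos (of_int (int k * N) * y))
      = (\<lambda>k. if k = 1 then cos (of_int N * y) else 0)"
    by (auto simp: profile_coeff_def fun_eq_iff)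
  then show ?thesis
    unfolding profile_def cos_series_def using sums_single[of 1 "\<lambda>_. cos (of_int N * y)"]
    by (simp add: sums_unique[symmetric])
qed

text \<open>Harmonics 0 and 1 are common to all profiles and cancel; the tail is dominated by d
  times the sum of \<open>k^-4\<close> over \<open>k >= 2\<close>.\<close>

lemma profile_diff_le:
  assumes x: "\<And>j. \<bar>x j\<bar> \<le> 1" and x': "\<And>j. \<bar>x' j\<bar> \<le> 1" and d: "\<And>j. \<bar>x j - x' j\<bar> \<le> d"
  shows "\<bar>profile N x y - profile N x' y\<bar> \<le> d"
proof -
  let ?q = "\<lambda>k::nat. if k < 2 then 0 else 1 / real k ^ 4"
  have d0: "d \<ge> 0" using d[of 0] by linarith
  have s: "(\<lambda>k. profile_coeff x k * cos (of_int (int k * N) * y) - profile_coeff x' k * cos (of_int (int k * N) * y))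
      sums (profile N x y - profile N x' y)"
    unfolding profile_def by (intro sums_diff cos_series_sums summable_profile_coeff x x')
  have le: "norm (profile_coeff x k * cos (of_int (int k * N) * y) - profile_coeff x' k * cos (of_int (int k * N) * y))
      \<le> d * ?q k" for k
  proof -
    have "profile_coeff x k * cos (of_int (int k * N) * y) - profile_coeff x' k * cos (of_int (int k * N) * y)
        = (if k < 2 then 0 else (x k - x' k) / real k ^ 4) * cos (of_int (int k * N) * y)"
      by (auto simp: profile_coeff_def algebra_simps diff_divide_distrib)
    moreover have "\<bar>(if k < 2 then 0 else (x k - x' k) / real k ^ 4) * cos (of_int (int k * N) * y)\<bar> \<le> d * ?q k * 1"
      unfolding abs_mult using d[of k] d0 by (intro mult_mono) (auto simp: divide_right_mono)
    ultimately show ?thesis by (simp only: real_norm_def mult_1_right)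
  qed
  have "norm (profile N x y - profile N x' y) \<le> (\<Sum>k. d * ?q k)"
    by (rule norm_sums_le[OF s summable_sums le]) (intro summable_mult sum_inverse_fourth)
  also have "\<dots> = d * suminf ?q" by (rule suminf_mult[OF sum_inverse_fourth(1)])
  also have "\<dots> \<le> d * 1" by (rule mult_left_mono[OF sum_inverse_fourth(2) d0])
  finally show ?thesis by simp
qed

lemma abs_profile_le:
  assumes "\<And>j. \<bar>x j\<bar> \<le> 1"
  shows "\<bar>profile N x y\<bar> \<le> 2"
proof -
  have "\<bar>profile N x y - profile N (\<lambda>_. 0) y\<bar> \<le> 1"
    by (rule profile_diff_le) (use assms in auto)
  moreover have "\<bar>profile N (\<lambda>_. 0) y\<bar> \<le> 1" by (simp add: profile_0)
  ultimately show ?thesis by linarith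
qed

lemma continuous_profile:
  assumes "\<And>j. \<bar>x j\<bar> \<le> 1"
  shows "continuous_on UNIV (profile N x)"
  unfolding profile_def by (rule continuous_cos_series[OF summable_profile_coeff[OF assms]])

lemma abs_cube_diff_le:
  fixes p q :: real
  assumes "\<bar>p\<bar> \<le> 2" "\<bar>q\<bar> \<le> 2"
  shows "\<bar>p ^ 3 - q ^ 3\<bar> \<le> 12 * \<bar>p - q\<bar>"
proof -
  have "\<bar>p ^ 3 - q ^ 3\<bar> = \<bar>p - q\<bar> * \<bar>p * p + p * q + q * q\<bar>"
    by (simp add: power3_eq_cube algebra_simps flip: abs_mult)
  also have "\<dots> \<le> \<bar>p - q\<bar> * (\<bar>p\<bar> * \<bar>p\<bar> + \<bar>p\<bar> * \<bar>q\<bar> + \<bar>q\<bar> * \<bar>q\<bar>)"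
  proof (intro mult_left_mono)
    have "\<bar>p * p + p * q + q * q\<bar> \<le> \<bar>p * p\<bar> + \<bar>p * q\<bar> + \<bar>q * q\<bar>" by linarith
    then show "\<bar>p * p + p * q + q * q\<bar> \<le> \<bar>p\<bar> * \<bar>p\<bar> + \<bar>p\<bar> * \<bar>q\<bar> + \<bar>q\<bar> * \<bar>q\<bar>"
      by (simp only: abs_mult)
  qed simp
  also have "\<dots> \<le> \<bar>p - q\<bar> * (2 * 2 + 2 * 2 + 2 * 2)"
    using assms by (intro mult_left_mono add_mono mult_mono) auto
  finally show ?thesis by simp
qed

text \<open>The 24 is \<open>2 * pi * 12 / pi\<close>: period length times the Lipschitz constant 12
  of the cube on [-2,2], divided by the normalisation. Likewise \<open>2 * pi * 2^3 / pi\<close> is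
  the 16 in the bound for a single coefficient.\<close>

lemma cubic_coeff_diff_le:
  assumes x: "\<And>j. \<bar>x j\<bar> \<le> 1" and x': "\<And>j. \<bar>x' j\<bar> \<le> 1" and d: "\<And>j. \<bar>x j - x' j\<bar> \<le> d"
  shows "\<bar>cubic_coeff N x k - cubic_coeff N x' k\<bar> \<le> 24 * d"
proof -
  have c: "continuous_on UNIV (\<lambda>y. profile N x y ^ 3)" "continuous_on UNIV (\<lambda>y. profile N x' y ^ 3)"
    by (intro continuous_intros continuous_profile x x')+
  have "cmod (fourier_coeff (\<lambda>y. profile N x y ^ 3 - profile N x' y ^ 3) (int k * N)) \<le> 2 * pi * (12 * d)"
  proof (rule norm_fourier_coeff_le)
    fix y
    show "\<bar>profile N x y ^ 3 - profile N x' y ^ 3\<bar> \<le> 12 * d"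
    proof -
      have "\<bar>profile N x y ^ 3 - profile N x' y ^ 3\<bar> \<le> 12 * \<bar>profile N x y - profile N x' y\<bar>"
        by (intro abs_cube_diff_le abs_profile_le x x')
      also have "\<dots> \<le> 12 * d" by (intro mult_left_mono profile_diff_le[OF x x' d]) simp
      finally show ?thesis .
    qed
  qed (intro continuous_intros c)
  moreover have "\<bar>Re (fourier_coeff (\<lambda>y. profile N x y ^ 3 - profile N x' y ^ 3) (int k * N))\<bar>
     = pi * \<bar>cubic_coeff N x k - cubic_coeff N x' k\<bar>"
    unfolding fourier_coeff_diff[OF c] cubic_coeff_def
    by (simp add: abs_mult flip: diff_divide_distrib)
  ultimately have "pi * \<bar>cubic_coeff N x k - cubic_coeff N x' k\<bar> \<le> pi * (24 * d)"
    using abs_Re_le_cmod[of "fourier_coeff (\<lambda>y. profile N x y ^ 3 - profile N x' y ^ 3) (int k * N)"] by linarith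
  then show ?thesis by (simp only: mult_le_cancel_left_pos[OF pi_gt_zero])
qed

lemma abs_cubic_coeff_le:
  assumes x: "\<And>j. \<bar>x j\<bar> \<le> 1"
  shows "\<bar>cubic_coeff N x k\<bar> \<le> 16"
proof -
  have "cmod (fourier_coeff (\<lambda>y. profile N x y ^ 3) (int k * N)) \<le> 2 * pi * 8"
  proof (rule norm_fourier_coeff_le)
    show "\<bar>profile N x y ^ 3\<bar> \<le> 8" for y
      using power_mono[OF abs_profile_le[where N = N and y = y, OF x], where n = 3] by (simp add: power_abs)
  qed (intro continuous_intros continuous_profile x)
  then have "\<bar>Re (fourier_coeff (\<lambda>y. profile N x y ^ 3) (int k * N))\<bar> \<le> 16 * pi"
    using abs_Re_le_cmod[of "fourier_coeff (\<lambda>y. profile N x y ^ 3) (int k * N)"] by simp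
  then show ?thesis by (simp add: cubic_coeff_def field_simps)
qed

text \<open>The triple-angle formula leaves 3/4 on the first harmonic; multiplied by
  \<open>\<mu> * a^2 / 3\<close> it becomes the speed shift \<open>\<mu> * a^2 / 4\<close>.\<close>

lemma cubic_coeff_0:
  assumes "N > 0"
  shows "cubic_coeff N (\<lambda>_. 0) 1 = 3 / 4"
proof -
  have "profile N (\<lambda>_. 0) y ^ 3 = 3 / 4 * cos (of_int N * y) + 1 / 4 * cos (of_int (3 * N) * y)" for y
    using cos_treble_cos[of "of_int N * y"] by (simp add: profile_0 mult.assoc diff_divide_distrib)
  then have "fourier_coeff (\<lambda>y. profile N (\<lambda>_. 0) y ^ 3) N
     = fourier_coeff (\<lambda>y. 3 / 4 * cos (of_int N * y) + 1 / 4 * cos (of_int (3 * N) * y)) N" by simp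
  also have "\<dots> = fourier_coeff (\<lambda>y. 3 / 4 * cos (of_int N * y)) N + fourier_coeff (\<lambda>y. 1 / 4 * cos (of_int (3 * N) * y)) N"
    by (rule fourier_coeff_add) (intro continuous_intros)+
  also have "\<dots> = of_real (3 / 4 * pi)"
    unfolding fourier_coeff_cmult fourier_coeff_cos using assms by simp
  finally have "Re (fourier_coeff (\<lambda>y. profile N (\<lambda>_. 0) y ^ 3) N) = 3 / 4 * pi"
    by (simp only: Re_complex_of_real)
  then show ?thesis by (simp add: cubic_coeff_def)
qed

section \<open>Existence of travelling waves\<close>


text \<open>With \<open>p\<close> the phase \<open>mk_phase\<close>, this is \<open>p(kN) / (kN) - p(N) / N\<close>.\<close>

definition detuning :: "real \<Rightarrow> int \<Rightarrow> nat \<Rightarrow> real" where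
  "detuning \<beta> N k = (of_int N)^4 * (real k ^ 4 - 1) + \<beta> * (of_int N)\<^sup>2 * ((real k)\<^sup>2 - 1)"

text \<open>For \<open>k >= 2\<close> at most half of \<open>k^4\<close> is lost in
  \<open>k^4 - 1\<close>, and the sign of \<beta> keeps the lower-order dispersion from
  counteracting the leading one.\<close>

lemma detuning_ge:
  assumes "\<beta> \<ge> 0" "k \<ge> 2"
  shows "(of_int N)^4 * real k ^ 4 / 2 \<le> detuning \<beta> N k"
proof -
  have k: "(real k)\<^sup>2 \<ge> 2\<^sup>2" "(real k) ^ 4 \<ge> 2 ^ 4"
    using assms(2) by (intro power_mono; simp)+
  have "(of_int N)^4 * (real k ^ 4 / 2) \<le> (of_int N)^4 * (real k ^ 4 - 1)"
    using k by (intro mult_left_mono) auto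
  moreover have "0 \<le> \<beta> * (of_int N)\<^sup>2 * ((real k)\<^sup>2 - 1)" using assms k by simp
  ultimately show ?thesis by (simp add: detuning_def)
qed

text \<open>Here e stands for \<open>\<mu> * a^2 / 3\<close>. The equation is that of mode
  \<open>kN\<close> divided by \<open>kN\<close>, after the speed has been eliminated through mode
  N; at \<open>k = 1\<close> it reads 0 = 0. For \<open>k >= 2\<close>, multiplication by
  \<open>k^4 / detuning\<close> makes it a fixed-point equation for x with a prefactor of at most
  \<open>2 / (3 N^4)\<close>. With \<open>N >= 4\<close> one has \<open>N^4 >= 256\<close>, enough
  both for mapping the unit ball to itself and for the contraction constant 1/2.\<close>

lemma profile_fixpoint:
  fixes e \<beta> :: real and N :: int
  assumes "N \<ge> 4" "\<beta> \<ge> 0" "\<bar>e\<bar> \<le> 1 / 3"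
  obtains x where "\<And>k. \<bar>x k\<bar> \<le> 1" "\<And>k. \<bar>x k\<bar> \<le> 22 / (of_int N)^4"
    "\<And>k. k \<ge> 1 \<Longrightarrow> detuning \<beta> N k * profile_coeff x k
        = e * (cubic_coeff N x 1 * profile_coeff x k - cubic_coeff N x k)"
proof -
  define r where "r k = real k ^ 4 / detuning \<beta> N k" for k
  define F where "F x k = (if k < 2 then 0
      else e * r k * (cubic_coeff N x 1 * (x k / real k ^ 4) - cubic_coeff N x k))" for x k
  have N4: "(of_int N :: real) ^ 4 \<ge> 256"
    using power_mono[of 4 "of_int N :: real" 4] assms(1) by simp
  have D0: "detuning \<beta> N k > 0" if "k \<ge> 2" for k
  proof -
    have "(0::real) < (of_int N)^4" using N4 by linarith
    then have "0 < (of_int N)^4 * real k ^ 4 / 2"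
      using that by (intro divide_pos_pos mult_pos_pos) auto
    with detuning_ge[OF assms(2) that, of N] show ?thesis by linarith
  qed
  have r: "0 \<le> r k" "r k \<le> 2 / (of_int N)^4" if "k \<ge> 2" for k
  proof -
    show "0 \<le> r k" using D0[OF that] by (simp add: r_def)
    have "(0::real) < (of_int N)^4" using N4 by linarith
    then have "r k \<le> real k ^ 4 / ((of_int N)^4 * real k ^ 4 / 2)"
      unfolding r_def using that D0[OF that]
      by (intro divide_left_mono detuning_ge assms mult_pos_pos divide_pos_pos) auto
    also have "\<dots> = 2 / (of_int N)^4" using that by simp
    finally show "r k \<le> 2 / (of_int N)^4" .
  qed
  have er: "\<bar>e * r k\<bar> \<le> 2 / 3 / (of_int N)^4" if "k \<ge> 2" for k
  proof -
    have "\<bar>e\<bar> * \<bar>r k\<bar> \<le> 1 / 3 * (2 / (of_int N)^4)"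
      using r[OF that] assms(3) by (intro mult_mono) auto
    then show ?thesis by (simp add: abs_mult)
  qed
  have div: "\<bar>a / real k ^ 4\<bar> \<le> \<bar>a\<bar>" if "k \<ge> 2" for a :: real and k
  proof -
    have "1 \<le> real k ^ 4" using that by (intro one_le_power) auto
    then show ?thesis using mult_left_mono[of 1 "real k ^ 4" "\<bar>a\<bar>"] by (simp add: divide_le_eq)
  qed
  have bound: "\<bar>F x k\<bar> \<le> 22 / (of_int N)^4" if x: "\<And>j. \<bar>x j\<bar> \<le> 1" for x k
  proof (cases "k < 2")
    case True
    then show ?thesis by (simp add: F_def)
  next
    case False
    then have k: "k \<ge> 2" by simp
    \<comment> \<open>Two terms of size 16 against the prefactor \<open>2 / (3 N^4)\<close> give
      64/3, rounded up to 22.\<close>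
    have "\<bar>cubic_coeff N x 1 * (x k / real k ^ 4)\<bar> \<le> 16 * 1"
      unfolding abs_mult using order_trans[OF div[OF k] x]
      by (intro mult_mono abs_cubic_coeff_le x) auto
    moreover have "\<bar>cubic_coeff N x k\<bar> \<le> 16" by (rule abs_cubic_coeff_le[OF x])
    ultimately have "\<bar>cubic_coeff N x 1 * (x k / real k ^ 4) - cubic_coeff N x k\<bar> \<le> 32" by linarith
    then have "\<bar>F x k\<bar> \<le> 2 / 3 / (of_int N)^4 * 32"
      using False er[OF k] unfolding F_def by (simp only: if_False abs_mult) (intro mult_mono, auto simp: abs_mult)
    also have "\<dots> = 64 / 3 / (of_int N)^4" by simp
    also have "\<dots> \<le> 22 / (of_int N)^4" by (rule divide_right_mono) auto
    finally show ?thesis .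
  qed
  have N22: "22 / (of_int N :: real)^4 \<le> 1"
    using N4 by (subst divide_le_eq_1_pos) linarith+
  have lip: "\<bar>F x k - F y k\<bar> \<le> 1 / 2 * d"
    if x: "\<And>j. \<bar>x j\<bar> \<le> 1" and y: "\<And>j. \<bar>y j\<bar> \<le> 1" and d: "\<And>j. \<bar>x j - y j\<bar> \<le> d" for x y d k
  proof (cases "k < 2")
    case True
    then show ?thesis using d[of 0] by (simp add: F_def)
  next
    case False
    then have k: "k \<ge> 2" by simp
    let ?b = "cubic_coeff N"
    have d0: "d \<ge> 0" using d[of 0] by linarith
    \<comment> \<open>The product is split so that one factor varies at a time; the three
      differences contribute 24 + 16 + 24 = 64.\<close>
    have "\<bar>(?b x 1 - ?b y 1) * (x k / real k ^ 4)\<bar> \<le> 24 * d * 1"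
      unfolding abs_mult using order_trans[OF div[OF k] x] d0
      by (intro mult_mono cubic_coeff_diff_le x y d) auto
    moreover have "\<bar>?b y 1 * ((x k - y k) / real k ^ 4)\<bar> \<le> 16 * d"
      unfolding abs_mult using order_trans[OF div[OF k] d]
      by (intro mult_mono abs_cubic_coeff_le y) auto
    moreover have "\<bar>?b x k - ?b y k\<bar> \<le> 24 * d" by (rule cubic_coeff_diff_le[OF x y d])
    moreover have "(?b x 1 * (x k / real k ^ 4) - ?b x k) - (?b y 1 * (y k / real k ^ 4) - ?b y k)
        = (?b x 1 - ?b y 1) * (x k / real k ^ 4) + ?b y 1 * ((x k - y k) / real k ^ 4) - (?b x k - ?b y k)"
      by (simp add: algebra_simps diff_divide_distrib)
    ultimately have "\<bar>(?b x 1 * (x k / real k ^ 4) - ?b x k) - (?b y 1 * (y k / real k ^ 4) - ?b y k)\<bar> \<le> 64 * d"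
      by linarith
    moreover have "F x k - F y k = e * r k *
        ((?b x 1 * (x k / real k ^ 4) - ?b x k) - (?b y 1 * (y k / real k ^ 4) - ?b y k))"
      using False by (simp add: F_def algebra_simps)
    moreover have "\<bar>e * r k\<bar> \<le> 1 / 128"
    proof -
      have "(0::real) < (of_int N)^4" using N4 by linarith
      then have "2 / 3 / (of_int N :: real)^4 \<le> 2 / 3 / 256" using N4 by (intro divide_left_mono) auto
      with er[OF k] show ?thesis by linarith
    qed
    ultimately have "\<bar>F x k - F y k\<bar> \<le> 1 / 128 * (64 * d)"
      using d0 by (simp only: abs_mult) (intro mult_mono, auto simp: abs_mult)
    then show ?thesis by simp
  qed
  obtain x where x: "\<And>j. \<bar>x j\<bar> \<le> 1" and Fx: "F x = x"
  proof (rule bounded_sequence_fixpoint[of F "1 / 2"])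
    show "\<bar>F x k\<bar> \<le> 1" if "\<And>j. \<bar>x j\<bar> \<le> 1" for x k
      by (rule order_trans[OF bound[OF that] N22])
  qed (use lip in auto)
  show thesis
  proof (rule that[of x])
    show "\<bar>x k\<bar> \<le> 1" for k by (rule x)
    show "\<bar>x k\<bar> \<le> 22 / (of_int N)^4" for k by (subst Fx[symmetric]) (rule bound[OF x])
    show "detuning \<beta> N k * profile_coeff x k = e * (cubic_coeff N x 1 * profile_coeff x k - cubic_coeff N x k)"
      if "k \<ge> 1" for k
    proof (cases "k = 1")
      case True
      then show ?thesis by (simp add: detuning_def profile_coeff_def)
    next
      case False
      with that have k: "k \<ge> 2" by simp
      have "x k = e * r k * (cubic_coeff N x 1 * (x k / real k ^ 4) - cubic_coeff N x k)"
        using fun_cong[OF Fx, of k] k by (simp add: F_def)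
      then have "detuning \<beta> N k * (x k / real k ^ 4) = detuning \<beta> N k *
          (e * r k * (cubic_coeff N x 1 * (x k / real k ^ 4) - cubic_coeff N x k) / real k ^ 4)" by metis
      also have "\<dots> = e * (cubic_coeff N x 1 * (x k / real k ^ 4) - cubic_coeff N x k)"
        using D0[OF k] k by (simp add: r_def)
      finally show ?thesis using k by (simp add: profile_coeff_def)
    qed
  qed
qed

text \<open>The amplitude is put in front of the normalised profile, so modes N and -N carry exactly
  \<open>a * pi\<close> and the nonlinear correction lives only on higher harmonics and in the
  speed.\<close>

lemma travelling_wave_exists:
  fixes a \<beta> \<gamma> \<mu> :: real and N :: int
  assumes N: "N \<ge> 4" and "\<beta> \<ge> 0" and \<mu>: "\<bar>\<mu>\<bar> = 1" and a: "0 < a" "a \<le> 1"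
  obtains \<phi> :: "real \<Rightarrow> real" and c C :: real where
    "continuous_on UNIV \<phi>" "\<And>x. \<phi> (x + 2*pi) = \<phi> x"
    "\<And>n. cmod (fourier_coeff \<phi> n) \<le> C / (1 + (of_int n)\<^sup>2)\<^sup>2"
    "\<And>n. of_real (of_int n * c - mk_phase \<beta> \<gamma> n) * fourier_coeff \<phi> n
        = of_real (\<mu> / 3) * of_int n * fourier_coeff (\<lambda>x. \<phi> x ^ 3) n"
    "\<And>n. \<bar>n\<bar> = N \<Longrightarrow> fourier_coeff \<phi> n = of_real (a * pi)"
    "\<And>n. \<bar>n\<bar> \<noteq> N \<Longrightarrow> cmod (fourier_coeff \<phi> n) \<le> 200 / ((of_int N)\<^sup>2 * (1 + (of_int n)\<^sup>2))"
    "\<bar>c - ((of_int N)^4 + \<beta> * (of_int N)\<^sup>2 - \<gamma> + \<mu> * a\<^sup>2 / 4)\<bar> \<le> 176 / (of_int N)^4"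
proof -
  define e where "e = \<mu> * a\<^sup>2 / 3"
  have a2: "a\<^sup>2 \<le> 1" using a by (simp add: power_le_one)
  have e: "\<bar>e\<bar> \<le> 1 / 3" using \<mu> a2 by (simp add: e_def abs_mult)
  from profile_fixpoint[OF N \<open>\<beta> \<ge> 0\<close> e] obtain x where
    x1: "\<And>k. \<bar>x k\<bar> \<le> 1" and x2: "\<And>k. \<bar>x k\<bar> \<le> 22 / (of_int N)^4" and
    xe: "\<And>k. k \<ge> 1 \<Longrightarrow> detuning \<beta> N k * profile_coeff x k
        = e * (cubic_coeff N x 1 * profile_coeff x k - cubic_coeff N x k)" by blast
  define \<psi> where "\<psi> = profile N x"
  \<comment> \<open>The speed solves the equation of mode N: the linear phase speed at N plus the
    contribution of the first harmonic of the cube.\<close>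
  define c where "c = (of_int N)^4 + \<beta> * (of_int N)\<^sup>2 - \<gamma> + e * cubic_coeff N x 1"
  have N0: "N > 0" using N by simp
  have cont: "continuous_on UNIV \<psi>" unfolding \<psi>_def by (rule continuous_profile[OF x1])
  have per: "\<psi> (y + 2*pi) = \<psi> y" for y by (simp add: \<psi>_def profile_def cos_series_2pi)
  have perN: "\<psi> (y + 2*pi / of_int N) = \<psi> y" for y
    using cos_series_periodic[OF N0] by (simp add: \<psi>_def profile_def)
  have even: "\<psi> (- y) = \<psi> y" for y by (simp add: \<psi>_def profile_def cos_series_even)
  have cont3: "continuous_on UNIV (\<lambda>y. \<psi> y ^ 3)" by (intro continuous_intros cont)
  have f1: "fourier_coeff \<psi> n = (if N dvd n then of_real (pi * profile_coeff x (nat (\<bar>n\<bar> div N))) else 0)" for n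
    unfolding \<psi>_def profile_def
    by (rule fourier_coeff_cos_series[OF summable_profile_coeff[OF x1] N0]) (simp add: profile_coeff_def)
  have f3: "fourier_coeff (\<lambda>y. \<psi> y ^ 3) n
      = (if N dvd n then of_real (pi * cubic_coeff N x (nat (\<bar>n\<bar> div N))) else 0)" for n
  proof (cases "N dvd n")
    case True
    then have n: "int (nat (\<bar>n\<bar> div N)) * N = \<bar>n\<bar>" using N0 by (simp add: pos_imp_zdiv_nonneg_iff)
    have "fourier_coeff (\<lambda>y. \<psi> y ^ 3) n = fourier_coeff (\<lambda>y. \<psi> y ^ 3) \<bar>n\<bar>"
      using fourier_coeff_even[OF cont3, of n] by (auto simp: per even abs_if)
    also have "\<dots> = of_real (Re (fourier_coeff (\<lambda>y. \<psi> y ^ 3) \<bar>n\<bar>))"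
      by (rule fourier_coeff_even_real[OF cont3]) (simp_all add: per even)
    also have "Re (fourier_coeff (\<lambda>y. \<psi> y ^ 3) \<bar>n\<bar>) = pi * cubic_coeff N x (nat (\<bar>n\<bar> div N))"
      unfolding cubic_coeff_def n by (simp add: \<psi>_def)
    finally show ?thesis using True by simp
  next
    case False
    then show ?thesis using fourier_coeff_eq_0[OF cont3, of N n] N0 by (simp add: per perN)
  qed
  have Re_N: "(of_int N :: real) \<ge> 4" using N by simp
  \<comment> \<open>The \<open>N^-4\<close> from the fixed point and the \<open>k^-4\<close> built
    into \<open>profile_coeff\<close> combine to \<open>n^-4\<close>, as
    \<open>\<bar>n\<bar> = k N\<close>. Harmonic 0 vanishes by definition, so every other surviving
    mode lies beyond N.\<close>
  have big: "cmod (fourier_coeff \<psi> n) \<le> 22 * pi / (of_int n)^4 \<and> N < \<bar>n\<bar> \<or> fourier_coeff \<psi> n = 0"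
    if n: "\<bar>n\<bar> \<noteq> N" for n
  proof (cases "N dvd n \<and> n \<noteq> 0")
    case False
    then show ?thesis by (auto simp: f1 profile_coeff_def)
  next
    case True
    define k where "k = nat (\<bar>n\<bar> div N)"
    have k: "int k * N = \<bar>n\<bar>" using N0 True by (simp add: k_def pos_imp_zdiv_nonneg_iff)
    have "k \<noteq> 0" using k True by (intro notI) simp
    moreover have "k \<noteq> 1" using k n by (intro notI) simp
    ultimately have k2: "k \<ge> 2" by simp
    then have "1 * N < int k * N" using N0 by (intro mult_strict_right_mono) auto
    then have "N < \<bar>n\<bar>" using k by simp
    moreover have "cmod (fourier_coeff \<psi> n) = pi * (\<bar>x k\<bar> / real k ^ 4)"
      using True k2 by (simp add: f1 k_def[symmetric] profile_coeff_def norm_mult norm_divide norm_power)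
    moreover have "pi * (\<bar>x k\<bar> / real k ^ 4) \<le> pi * (22 / (of_int N)^4 / real k ^ 4)"
      by (intro mult_left_mono divide_right_mono x2) auto
    moreover have "(of_int n :: real)^4 = (of_int N)^4 * real k ^ 4"
    proof -
      have "(of_int n :: real)^4 = \<bar>of_int n\<bar>^4" by simp
      also have "\<bar>of_int n :: real\<bar> = real k * of_int N" using arg_cong[OF k, of real_of_int] by simp
      finally show ?thesis by (simp add: power_mult_distrib)
    qed
    ultimately show ?thesis by (simp add: mult.commute)
  qed
  have Q: "1 + (of_int n)\<^sup>2 \<le> 2 * (of_int n :: real)\<^sup>2" if "n \<noteq> 0" for n
  proof -
    have "1 \<le> (of_int \<bar>n\<bar> :: real)" using that by (simp only: of_int_1_le_iff)
    then have "1 \<le> (of_int n :: real)\<^sup>2" using power_mono[of 1 "of_int \<bar>n\<bar> :: real" 2] by simp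
    then show ?thesis by simp
  qed
  have pos: "0 < 1 + (of_int n :: real)\<^sup>2" for n by (simp add: add_pos_nonneg)
  have pi: "pi \<le> 4" using pi_less_4 by simp
  show thesis
  \<comment> \<open>In the decay constant the first summand serves the modes N and -N, and 400
    dominates the \<open>88 * pi\<close> of all higher ones.\<close>
  proof (rule that[of "\<lambda>y. a * \<psi> y" "4 * pi * (1 + (of_int N)\<^sup>2)\<^sup>2 + 400" c])
    show "continuous_on UNIV (\<lambda>y. a * \<psi> y)" by (intro continuous_intros cont)
    show "a * \<psi> (y + 2*pi) = a * \<psi> y" for y by (simp add: per)
    show *: "fourier_coeff (\<lambda>y. a * \<psi> y) n = of_real (a * pi)" if "\<bar>n\<bar> = N" for n
    proof -
      have "N dvd n" using that by auto
      then show ?thesis using that N0 by (simp add: fourier_coeff_cmult f1 profile_coeff_def)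
    qed
    have ac: "cmod (fourier_coeff (\<lambda>y. a * \<psi> y) n) \<le> cmod (fourier_coeff \<psi> n)" for n
      using a by (simp add: fourier_coeff_cmult norm_mult mult_left_le_one_le)
    show "cmod (fourier_coeff (\<lambda>y. a * \<psi> y) n) \<le> (4 * pi * (1 + (of_int N)\<^sup>2)\<^sup>2 + 400) / (1 + (of_int n)\<^sup>2)\<^sup>2" for n
    proof (cases "\<bar>n\<bar> = N")
      case True
      then have "(of_int n :: real)\<^sup>2 = (of_int N)\<^sup>2" by auto
      moreover have "a * pi \<le> (4 * pi * (1 + (of_int N)\<^sup>2)\<^sup>2 + 400) / (1 + (of_int N)\<^sup>2)\<^sup>2"
      proof -
        define q where "q = (1 + (of_int N :: real)\<^sup>2)\<^sup>2"
        have "q > 0" unfolding q_def by (intro zero_less_power add_pos_nonneg) auto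
        have "(a * pi) * q \<le> (1 * pi) * q" using a \<open>q > 0\<close> by (intro mult_right_mono) auto
        also have "\<dots> \<le> 4 * pi * q + 400" using \<open>q > 0\<close> by simp
        finally show ?thesis using \<open>q > 0\<close> by (simp only: pos_le_divide_eq q_def)
      qed
      ultimately show ?thesis
        using *[OF True] a by (simp only: norm_of_real) simp
    next
      case False
      show ?thesis
      proof (cases "fourier_coeff \<psi> n = 0")
        case True
        then show ?thesis by (simp add: fourier_coeff_cmult)
      next
        case nz: False
        with big[OF False] N0 have n: "n \<noteq> 0" "cmod (fourier_coeff \<psi> n) \<le> 22 * pi / (of_int n)^4" by auto
        have "(1 + (of_int n :: real)\<^sup>2)\<^sup>2 \<le> (2 * (of_int n)\<^sup>2)\<^sup>2"
          by (rule power_mono[OF Q[OF n(1)]]) simp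
        also have "\<dots> = 4 * (of_int n)^4" by (simp add: power_mult_distrib flip: power_mult)
        finally have q: "(1 + (of_int n :: real)\<^sup>2)\<^sup>2 \<le> 4 * (of_int n)^4" .
        have "cmod (fourier_coeff (\<lambda>y. a * \<psi> y) n) \<le> 88 * pi / (4 * (of_int n)^4)"
          using ac[of n] n by simp
        also have "\<dots> \<le> 88 * pi / (1 + (of_int n :: real)\<^sup>2)\<^sup>2"
          using n(1) q pos[of n] by (intro divide_left_mono mult_pos_pos) (auto simp: zero_less_power_eq)
        also have "\<dots> \<le> (4 * pi * (1 + (of_int N)\<^sup>2)\<^sup>2 + 400) / (1 + (of_int n :: real)\<^sup>2)\<^sup>2"
          using pi by (intro divide_right_mono) (auto intro: add_increasing)
        finally show ?thesis .
      qed
    qed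
    show "cmod (fourier_coeff (\<lambda>y. a * \<psi> y) n) \<le> 200 / ((of_int N)\<^sup>2 * (1 + (of_int n)\<^sup>2))" if "\<bar>n\<bar> \<noteq> N" for n
    proof (cases "fourier_coeff \<psi> n = 0")
      case True
      then show ?thesis by (simp add: fourier_coeff_cmult)
    next
      case False
      with big[OF that] have n: "N < \<bar>n\<bar>" "cmod (fourier_coeff \<psi> n) \<le> 22 * pi / (of_int n)^4" by auto
      then have n0: "n \<noteq> 0" using N0 by auto
      have "(of_int N :: real) \<le> \<bar>of_int n\<bar>" using n(1) by linarith
      then have "(of_int N :: real)\<^sup>2 \<le> (of_int n)\<^sup>2" using N0 power_mono[of "of_int N :: real" "\<bar>of_int n\<bar>" 2] by simp
      then have "(of_int N)\<^sup>2 * (1 + (of_int n :: real)\<^sup>2) \<le> (of_int n)\<^sup>2 * (2 * (of_int n)\<^sup>2)"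
        by (intro mult_mono Q n0) auto
      also have "\<dots> = 2 * (of_int n)^4" by (simp flip: power_add)
      finally have q: "(of_int N)\<^sup>2 * (1 + (of_int n :: real)\<^sup>2) \<le> 2 * (of_int n)^4" .
      \<comment> \<open>Since \<open>N < \<bar>n\<bar>\<close>, two of the four powers of n are
        traded for \<open>N^2\<close>, which will make the higher harmonics negligible in the
        Sobolev norm. The 200 dominates \<open>44 * pi\<close>.\<close>
      have "cmod (fourier_coeff (\<lambda>y. a * \<psi> y) n) \<le> 44 * pi / (2 * (of_int n)^4)"
        using ac[of n] n by simp
      also have "\<dots> \<le> 44 * pi / ((of_int N)\<^sup>2 * (1 + (of_int n :: real)\<^sup>2))"
        using n0 N0 q pos[of n] by (intro divide_left_mono mult_pos_pos) (auto simp: zero_less_power_eq)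
      also have "\<dots> \<le> 200 / ((of_int N)\<^sup>2 * (1 + (of_int n :: real)\<^sup>2))"
        using pi by (intro divide_right_mono) auto
      finally show ?thesis .
    qed
    show "of_real (of_int n * c - mk_phase \<beta> \<gamma> n) * fourier_coeff (\<lambda>y. a * \<psi> y) n
        = of_real (\<mu> / 3) * of_int n * fourier_coeff (\<lambda>y. (a * \<psi> y) ^ 3) n" for n
    proof (cases "N dvd n \<and> n \<noteq> 0")
      case False
      then show ?thesis
        by (auto simp: power_mult_distrib fourier_coeff_cmult f1 f3 mk_phase_def)
    next
      case True
      define k where "k = nat (\<bar>n\<bar> div N)"
      have k: "int k * N = \<bar>n\<bar>" using N0 True by (simp add: k_def pos_imp_zdiv_nonneg_iff)
      have k1: "k \<ge> 1" using k True by (cases k) auto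
      have sq: "(of_int n :: real)\<^sup>2 = (real k)\<^sup>2 * (of_int N)\<^sup>2"
        using arg_cong[OF k, of "\<lambda>z. (real_of_int z)\<^sup>2"] by (simp add: power_mult_distrib)
      then have sq2: "(of_int n :: real)^4 = real k ^ 4 * (of_int N)^4"
        by (metis (no_types, lifting) power_mult_distrib power2_eq_square mult_2 numeral_Bit0 power_add)
      \<comment> \<open>With the factor n taken out, the linear operator at harmonic k is the cubic
        speed shift minus the detuning, the form in which the fixed-point equation applies.\<close>
      have "of_int n * c - mk_phase \<beta> \<gamma> n = of_int n * (c - ((of_int n)^4 + \<beta> * (of_int n)\<^sup>2 - \<gamma>))"
        by (simp add: mk_phase_def algebra_simps power_numeral_reduce)
      also have "\<dots> = of_int n * (e * cubic_coeff N x 1 - detuning \<beta> N k)"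
        unfolding sq sq2 by (simp add: c_def detuning_def algebra_simps)
      finally have eq0: "of_int n * c - mk_phase \<beta> \<gamma> n = of_int n * (e * cubic_coeff N x 1 - detuning \<beta> N k)" .
      have "(of_int n * c - mk_phase \<beta> \<gamma> n) * profile_coeff x k
          = of_int n * (e * cubic_coeff N x 1 * profile_coeff x k - detuning \<beta> N k * profile_coeff x k)"
        unfolding eq0 by (simp add: algebra_simps)
      also have "\<dots> = of_int n * (e * cubic_coeff N x k)"
        unfolding xe[OF k1] by (simp add: algebra_simps)
      finally have eq: "(of_int n * c - mk_phase \<beta> \<gamma> n) * profile_coeff x k = of_int n * (e * cubic_coeff N x k)" .
      have "(of_int n * c - mk_phase \<beta> \<gamma> n) * (a * (pi * profile_coeff x k))
          = a * pi * ((of_int n * c - mk_phase \<beta> \<gamma> n) * profile_coeff x k)" by (simp add: mult_ac)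
      also have "\<dots> = \<mu> / 3 * of_int n * (a ^ 3 * (pi * cubic_coeff N x k))"
        unfolding eq e_def by (simp add: power2_eq_square power3_eq_cube)
      finally have "complex_of_real ((of_int n * c - mk_phase \<beta> \<gamma> n) * (a * (pi * profile_coeff x k)))
          = of_real (\<mu> / 3 * of_int n * (a ^ 3 * (pi * cubic_coeff N x k)))" by (rule arg_cong)
      then show ?thesis
        using True by (simp add: power_mult_distrib fourier_coeff_cmult f1 f3 k_def[symmetric])
    qed
    show "\<bar>c - ((of_int N)^4 + \<beta> * (of_int N)\<^sup>2 - \<gamma> + \<mu> * a\<^sup>2 / 4)\<bar> \<le> 176 / (of_int N)^4"
    proof -
      \<comment> \<open>Comparison with the pure cosine: x is within \<open>22 / N^4\<close> of the
        zero sequence, and 176 is \<open>24 * 22 / 3\<close>.\<close>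
      have "\<bar>cubic_coeff N x 1 - cubic_coeff N (\<lambda>_. 0) 1\<bar> \<le> 24 * (22 / (of_int N)^4)"
        by (rule cubic_coeff_diff_le) (use x1 x2 in auto)
      then have "\<bar>cubic_coeff N x 1 - 3 / 4\<bar> \<le> 24 * (22 / (of_int N)^4)"
        by (simp only: cubic_coeff_0[OF N0])
      then have "\<bar>e\<bar> * \<bar>cubic_coeff N x 1 - 3 / 4\<bar> \<le> 1 / 3 * (24 * (22 / (of_int N)^4))"
        using e by (intro mult_mono) auto
      moreover have "c - ((of_int N)^4 + \<beta> * (of_int N)\<^sup>2 - \<gamma> + \<mu> * a\<^sup>2 / 4) = e * (cubic_coeff N x 1 - 3 / 4)"
        by (simp add: c_def e_def algebra_simps)
      ultimately show ?thesis by (simp add: abs_mult)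
    qed
  qed
qed

section \<open>Two waves in phase opposition\<close>


definition weight_sum :: real where
  "weight_sum = infsum (\<lambda>n::int. 1 / (1 + (of_int n)\<^sup>2)) UNIV"

text \<open>Only the two main modes keep the true weight. On the others the weight is at most
  \<open>1 + n^2\<close>, which cancels one of the two such factors in the squared bound and leaves
  a multiple of \<open>N^-4 / (1 + n^2)\<close>.\<close>

lemma hs_norm_concentrated:
  fixes N :: int
  assumes "s \<le> 1" "N > 0"
    and off: "\<And>n. \<bar>n\<bar> \<noteq> N \<Longrightarrow> cmod (fourier_coeff f n) \<le> b / ((of_int N)\<^sup>2 * (1 + (of_int n)\<^sup>2))"
    and on: "\<And>n. \<bar>n\<bar> = N \<Longrightarrow> cmod (fourier_coeff f n) \<le> d"
  shows "hs_weight s f summable_on UNIV"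
    and "(hs_norm s f)\<^sup>2 \<le> 1 / (2*pi) * (2 * (1 + (of_int N)\<^sup>2) powr s * d\<^sup>2 + b\<^sup>2 / (of_int N)^4 * weight_sum)"
proof -
  let ?q = "\<lambda>n::int. 1 + (of_int n)\<^sup>2 :: real"
  define A where "A = ?q N powr s * d\<^sup>2"
  define g1 where "g1 n = (if n \<in> {N, - N} then A else 0)" for n
  define g2 where "g2 n = b\<^sup>2 / (of_int N)^4 * (1 / ?q n)" for n
  have q: "?q n > 0" for n by (simp add: add_pos_nonneg)
  have A: "A \<ge> 0" by (simp add: A_def)
  have g2: "g2 n \<ge> 0" for n by (simp add: g2_def)
  have le: "hs_weight s f n \<le> g1 n + g2 n" for n
  proof (cases "\<bar>n\<bar> = N")
    case True
    then have "n \<in> {N, -N}" by auto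
    moreover have "(of_int n :: real)\<^sup>2 = (of_int N)\<^sup>2" using True by auto
    moreover have "(cmod (fourier_coeff f n))\<^sup>2 \<le> d\<^sup>2" using on[OF True] by (intro power_mono) auto
    ultimately have "hs_weight s f n \<le> g1 n"
      unfolding hs_weight_def g1_def A_def by (auto intro!: mult_left_mono)
    with g2[of n] show ?thesis by linarith
  next
    case False
    have "hs_weight s f n \<le> ?q n * (b / ((of_int N)\<^sup>2 * ?q n))\<^sup>2"
      by (rule hs_weight_le[OF \<open>s \<le> 1\<close> off[OF False]])
    also have "\<dots> = g2 n"
    proof -
      have "x * (b / (m\<^sup>2 * x))\<^sup>2 = b\<^sup>2 / m^4 * (1 / x)" if "x > 0" "m > 0" for x m :: real
        using that by (simp add: field_simps power2_eq_square power4_eq_xxxx)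
      then show ?thesis using q[of n] \<open>N > 0\<close> by (simp add: g2_def)
    qed
    finally show ?thesis using A by (simp add: g1_def)
  qed
  have s1: "(g1 has_sum (\<Sum>n\<in>{N, -N}. A)) UNIV"
    by (rule has_sum_cong_neutral[THEN iffD1, OF _ _ _ has_sum_finite[of "{N, -N}"]]) (auto simp: g1_def)
  have s2: "(g2 has_sum (b\<^sup>2 / (of_int N)^4 * weight_sum)) UNIV"
    unfolding g2_def weight_sum_def
    by (intro has_sum_cmult_right has_sum_infsum summable_on_inverse_1_square)
  note s = has_sum_add[OF s1 s2]
  have "(\<Sum>n\<in>{N, -N}. A) = 2 * A" using \<open>N > 0\<close> by simp
  with infsumI[OF s] have inf: "infsum (\<lambda>n. g1 n + g2 n) UNIV = 2 * A + b\<^sup>2 / (of_int N)^4 * weight_sum" by simp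
  show "hs_weight s f summable_on UNIV" by (rule hs_norm_le(1)[OF le has_sum_imp_summable[OF s]])
  show "(hs_norm s f)\<^sup>2 \<le> 1 / (2*pi) * (2 * ?q N powr s * d\<^sup>2 + b\<^sup>2 / (of_int N)^4 * weight_sum)"
    using hs_norm_le(2)[OF le has_sum_imp_summable[OF s]] unfolding inf by (simp only: A_def mult.assoc)
qed

lemma weight_sum_nonneg: "weight_sum \<ge> 0"
  unfolding weight_sum_def by (rule infsum_nonneg) simp

text \<open>\<open>gap\<close> forces the phases of the two N-th modes to drift apart at rate at
  least \<open>pi / T\<close>, so opposition occurs by time T. There the moduli add up to
  \<open>a1 + a2\<close>, while initially they subtract to \<open>a1 - a2\<close>; mode N alone
  provides the last bound.\<close>

lemma wave_pair_exists:
  fixes a1 a2 \<beta> \<gamma> \<mu> s T :: real and N :: int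
  assumes s: "s \<le> 1" and N: "N \<ge> 4" and "\<beta> \<ge> 0" and "\<bar>\<mu>\<bar> = 1"
    and a: "0 < a2" "a2 < a1" "a1 \<le> 1" and "T > 0"
    and gap: "pi / T \<le> of_int N * ((a1\<^sup>2 - a2\<^sup>2) / 4 - 352 / (of_int N)^4)"
  obtains v1 v2 t where
    "mkaw_solution \<beta> \<gamma> \<mu> s T v1" "mkaw_solution \<beta> \<gamma> \<mu> s T v2" "t \<in> {0..T}"
    "(hs_norm s (v1 0))\<^sup>2 \<le> 1 / (2*pi) * (2 * (1 + (of_int N)\<^sup>2) powr s * (a1 * pi)\<^sup>2 + 200\<^sup>2 / (of_int N)^4 * weight_sum)"
    "(hs_norm s (v2 0))\<^sup>2 \<le> 1 / (2*pi) * (2 * (1 + (of_int N)\<^sup>2) powr s * (a2 * pi)\<^sup>2 + 200\<^sup>2 / (of_int N)^4 * weight_sum)"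
    "(hs_norm s (\<lambda>x. v1 0 x - v2 0 x))\<^sup>2
       \<le> 1 / (2*pi) * (2 * (1 + (of_int N)\<^sup>2) powr s * ((a1 - a2) * pi)\<^sup>2 + 400\<^sup>2 / (of_int N)^4 * weight_sum)"
    "1 / (2*pi) * ((1 + (of_int N)\<^sup>2) powr s * ((a1 + a2) * pi)\<^sup>2) \<le> (hs_norm s (\<lambda>x. v1 t x - v2 t x))\<^sup>2"
proof -
  have a1: "0 < a1" "a2 \<le> 1" using a by auto
  have N0: "N > 0" using N by simp
  obtain p1 c1 C1 where p1: "continuous_on UNIV p1" "\<And>x. p1 (x + 2*pi) = p1 x"
    "\<And>n. cmod (fourier_coeff p1 n) \<le> C1 / (1 + (of_int n)\<^sup>2)\<^sup>2"
    "\<And>n. of_real (of_int n * c1 - mk_phase \<beta> \<gamma> n) * fourier_coeff p1 n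
        = of_real (\<mu> / 3) * of_int n * fourier_coeff (\<lambda>x. p1 x ^ 3) n"
    "\<And>n. \<bar>n\<bar> = N \<Longrightarrow> fourier_coeff p1 n = of_real (a1 * pi)"
    "\<And>n. \<bar>n\<bar> \<noteq> N \<Longrightarrow> cmod (fourier_coeff p1 n) \<le> 200 / ((of_int N)\<^sup>2 * (1 + (of_int n)\<^sup>2))"
    "\<bar>c1 - ((of_int N)^4 + \<beta> * (of_int N)\<^sup>2 - \<gamma> + \<mu> * a1\<^sup>2 / 4)\<bar> \<le> 176 / (of_int N)^4"
    by (rule travelling_wave_exists[OF N \<open>\<beta> \<ge> 0\<close> \<open>\<bar>\<mu>\<bar> = 1\<close> a1(1) a(3), where \<gamma> = \<gamma>]) blast
  obtain p2 c2 C2 where p2: "continuous_on UNIV p2" "\<And>x. p2 (x + 2*pi) = p2 x"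
    "\<And>n. cmod (fourier_coeff p2 n) \<le> C2 / (1 + (of_int n)\<^sup>2)\<^sup>2"
    "\<And>n. of_real (of_int n * c2 - mk_phase \<beta> \<gamma> n) * fourier_coeff p2 n
        = of_real (\<mu> / 3) * of_int n * fourier_coeff (\<lambda>x. p2 x ^ 3) n"
    "\<And>n. \<bar>n\<bar> = N \<Longrightarrow> fourier_coeff p2 n = of_real (a2 * pi)"
    "\<And>n. \<bar>n\<bar> \<noteq> N \<Longrightarrow> cmod (fourier_coeff p2 n) \<le> 200 / ((of_int N)\<^sup>2 * (1 + (of_int n)\<^sup>2))"
    "\<bar>c2 - ((of_int N)^4 + \<beta> * (of_int N)\<^sup>2 - \<gamma> + \<mu> * a2\<^sup>2 / 4)\<bar> \<le> 176 / (of_int N)^4"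
    by (rule travelling_wave_exists[OF N \<open>\<beta> \<ge> 0\<close> \<open>\<bar>\<mu>\<bar> = 1\<close> a(1) a1(2), where \<gamma> = \<gamma>]) blast
  \<comment> \<open>The rate at which the phases of the \<open>N\<close>-th modes drift apart.\<close>
  define w where "w = of_int N * (c1 - c2)"
  define t where "t = pi / \<bar>w\<bar>"
  \<comment> \<open>The linear speeds are equal and cancel; 352 collects the error 176 of each
    speed.\<close>
  have "(a1\<^sup>2 - a2\<^sup>2) / 4 - 352 / (of_int N)^4 \<le> \<bar>c1 - c2\<bar>"
  proof -
    have "a2\<^sup>2 \<le> a1\<^sup>2" using a by (intro power_mono) auto
    then have "\<bar>\<mu> * (a1\<^sup>2 / 4 - a2\<^sup>2 / 4)\<bar> = (a1\<^sup>2 - a2\<^sup>2) / 4"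
      using \<open>\<bar>\<mu>\<bar> = 1\<close> by (simp add: abs_mult)
    then have "\<bar>\<mu> * a1\<^sup>2 / 4 - \<mu> * a2\<^sup>2 / 4\<bar> = (a1\<^sup>2 - a2\<^sup>2) / 4"
      by (simp add: right_diff_distrib)
    then show ?thesis using p1(7) p2(7) by linarith
  qed
  then have "of_int N * ((a1\<^sup>2 - a2\<^sup>2) / 4 - 352 / (of_int N)^4) \<le> of_int N * \<bar>c1 - c2\<bar>"
    using N0 by (intro mult_left_mono) auto
  also have "\<dots> = \<bar>w\<bar>" using N0 by (simp add: w_def abs_mult)
  finally have w: "pi / T \<le> \<bar>w\<bar>" using gap by linarith
  have w0: "\<bar>w\<bar> > 0" using w \<open>T > 0\<close> by (smt (verit) divide_pos_pos pi_gt_zero)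
  have t: "t \<in> {0..T}"
    using w w0 \<open>T > 0\<close> by (simp add: t_def field_simps)
  define v1 where "v1 = (\<lambda>t x. p1 (x + c1 * t))"
  define v2 where "v2 = (\<lambda>t x. p2 (x + c2 * t))"
  have c: "continuous_on UNIV (v1 t)" "continuous_on UNIV (v2 t)" for t
    unfolding v1_def v2_def
    by (intro continuous_on_compose2[OF p1(1)] continuous_on_compose2[OF p2(1)] continuous_intros; simp)+
  have f: "fourier_coeff (v1 t) n = cis (of_int n * (c1 * t)) * fourier_coeff p1 n"
    "fourier_coeff (v2 t) n = cis (of_int n * (c2 * t)) * fourier_coeff p2 n" for t n
    unfolding v1_def v2_def by (rule fourier_coeff_shift[OF p1(1,2)] fourier_coeff_shift[OF p2(1,2)])+
  have fd: "fourier_coeff (\<lambda>x. v1 t x - v2 t x) n = fourier_coeff (v1 t) n - fourier_coeff (v2 t) n" for t n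
    by (rule fourier_coeff_diff[OF c])
  have off1: "cmod (fourier_coeff (v1 t) n) \<le> 200 / ((of_int N)\<^sup>2 * (1 + (of_int n)\<^sup>2))"
    and off2: "cmod (fourier_coeff (v2 t) n) \<le> 200 / ((of_int N)\<^sup>2 * (1 + (of_int n)\<^sup>2))"
    if "\<bar>n\<bar> \<noteq> N" for n t
    using p1(6)[OF that] p2(6)[OF that] by (simp_all add: f norm_mult)
  have on1: "cmod (fourier_coeff (v1 t) n) \<le> a1 * pi" and on2: "cmod (fourier_coeff (v2 t) n) \<le> a2 * pi"
    if "\<bar>n\<bar> = N" for n t
    using p1(5)[OF that] p2(5)[OF that] a a1 by (simp_all add: f norm_mult)
  have off: "cmod (fourier_coeff (\<lambda>x. v1 t x - v2 t x) n) \<le> 400 / ((of_int N)\<^sup>2 * (1 + (of_int n)\<^sup>2))"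
    if "\<bar>n\<bar> \<noteq> N" for n t
    unfolding fd using off1[OF that, of t] off2[OF that, of t] norm_triangle_ineq4[of "fourier_coeff (v1 t) n" "fourier_coeff (v2 t) n"]
    by simp
  have ont: "cmod (fourier_coeff (\<lambda>x. v1 t x - v2 t x) n) \<le> a1 * pi + a2 * pi" if "\<bar>n\<bar> = N" for n
    unfolding fd using on1[OF that, of t] on2[OF that, of t] norm_triangle_ineq4[of "fourier_coeff (v1 t) n" "fourier_coeff (v2 t) n"]
    by simp
  have on0: "cmod (fourier_coeff (\<lambda>x. v1 0 x - v2 0 x) n) \<le> (a1 - a2) * pi" if "\<bar>n\<bar> = N" for n
  proof -
    have "fourier_coeff (\<lambda>x. v1 0 x - v2 0 x) n = of_real ((a1 - a2) * pi)"
      unfolding fd f by (simp add: p1(5)[OF that] p2(5)[OF that] algebra_simps)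
    then show ?thesis using a by (simp only: norm_of_real) simp
  qed
  \<comment> \<open>The sign of the drift depends on \<mu>, but a half turn in either direction
    gives the factor -1.\<close>
  have "w * t = pi \<or> w * t = - pi" using w0 by (auto simp: t_def abs_if)
  then have cw: "cis (w * t) = - 1" by (auto simp: complex_eq_iff)
  have "of_int N * (c1 * t) = of_int N * (c2 * t) + w * t" by (simp add: w_def algebra_simps)
  then have "cis (of_int N * (c1 * t)) = - cis (of_int N * (c2 * t))"
    using cw by (simp flip: cis_mult)
  then have "fourier_coeff (\<lambda>x. v1 t x - v2 t x) N = - cis (of_int N * (c2 * t)) * of_real ((a1 + a2) * pi)"
    unfolding fd f using N0 by (simp add: p1(5) p2(5) algebra_simps)
  then have fN: "cmod (fourier_coeff (\<lambda>x. v1 t x - v2 t x) N) = (a1 + a2) * pi"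
    using a a1 by (simp only: norm_mult norm_minus_cancel norm_cis norm_of_real) simp
  show thesis
  proof (rule that[of v1 v2 t])
    show "mkaw_solution \<beta> \<gamma> \<mu> s T v1" "mkaw_solution \<beta> \<gamma> \<mu> s T v2"
      unfolding v1_def v2_def
      by (rule mkaw_solution_travelling_wave[OF s p1(1-4)] mkaw_solution_travelling_wave[OF s p2(1-4)])+
    show "1 / (2*pi) * ((1 + (of_int N)\<^sup>2) powr s * ((a1 + a2) * pi)\<^sup>2) \<le> (hs_norm s (\<lambda>x. v1 t x - v2 t x))\<^sup>2"
    proof -
      have "hs_weight s (\<lambda>x. v1 t x - v2 t x) summable_on UNIV"
        by (rule hs_norm_concentrated(1)[OF s N0 off ont])
      from hs_norm_ge[OF this, of N] show ?thesis by (simp only: hs_weight_def fN)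
    qed
  qed (rule t hs_norm_concentrated(2)[OF s N0 off1 on1] hs_norm_concentrated(2)[OF s N0 off2 on2]
      hs_norm_concentrated(2)[OF s N0 off on0]; assumption)+
qed


section \<open>Contradiction with a uniform modulus of continuity\<close>

theorem theorem1p4:
  fixes s \<beta> \<gamma> \<mu> :: real
  assumes "0 \<le> s" and "s < 1/2" and "\<beta> \<ge> 0" and "\<mu> = 1 \<or> \<mu> = -1"
  shows "\<not> (\<forall>R>0. \<exists>T>0. \<exists>\<zeta> :: real \<Rightarrow> real.
              continuous_on {0..} \<zeta> \<and> (\<zeta> \<longlongrightarrow> 0) (at 0 within {0..}) \<and>
              (\<forall>v1 v2. mkaw_solution \<beta> \<gamma> \<mu> s T v1 \<and> mkaw_solution \<beta> \<gamma> \<mu> s T v2 \<and>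
                   hs_norm s (v1 0) \<le> R \<and> hs_norm s (v2 0) \<le> R \<longrightarrow>
                   (\<forall>t\<in>{0..T}. hs_norm s (\<lambda>x. v1 t x - v2 t x)
                                  \<le> \<zeta> (hs_norm s (\<lambda>x. v1 0 x - v2 0 x)))))"
proof
  assume H: "\<forall>R>0. \<exists>T>0. \<exists>\<zeta> :: real \<Rightarrow> real.
              continuous_on {0..} \<zeta> \<and> (\<zeta> \<longlongrightarrow> 0) (at 0 within {0..}) \<and>
              (\<forall>v1 v2. mkaw_solution \<beta> \<gamma> \<mu> s T v1 \<and> mkaw_solution \<beta> \<gamma> \<mu> s T v2 \<and>
                   hs_norm s (v1 0) \<le> R \<and> hs_norm s (v2 0) \<le> R \<longrightarrow>
                   (\<forall>t\<in>{0..T}. hs_norm s (\<lambda>x. v1 t x - v2 t x)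
                                  \<le> \<zeta> (hs_norm s (\<lambda>x. v1 0 x - v2 0 x))))"
  \<comment> \<open>R must be fixed before the frequency. It bounds the data of all pairs, using
    that the normalised main weight \<open>W * M^2\<close> below is at most 2 and that
    \<open>N^-4\<close> is at most 1.\<close>
  define R where "R = sqrt (1 / (2*pi) * (4 * pi\<^sup>2 + 200\<^sup>2 * weight_sum))"
  have Rpos: "1 / (2*pi) * (4 * pi\<^sup>2 + 200\<^sup>2 * weight_sum) > 0"
    using weight_sum_nonneg by (intro mult_pos_pos add_pos_nonneg) auto
  then have "R > 0" by (simp add: R_def)
  from H[rule_format, OF this] obtain T \<zeta> where "T > 0" and \<zeta>: "continuous_on {0..} \<zeta>" "(\<zeta> \<longlongrightarrow> 0) (at 0 within {0..})" and
    flow: "\<forall>v1 v2. mkaw_solution \<beta> \<gamma> \<mu> s T v1 \<and> mkaw_solution \<beta> \<gamma> \<mu> s T v2 \<and>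
      hs_norm s (v1 0) \<le> R \<and> hs_norm s (v2 0) \<le> R \<longrightarrow>
      (\<forall>t\<in>{0..T}. hs_norm s (\<lambda>x. v1 t x - v2 t x) \<le> \<zeta> (hs_norm s (\<lambda>x. v1 0 x - v2 0 x)))"
    by (elim exE conjE) (rule that)
  \<comment> \<open>\<open>at 0 within {0..}\<close> omits the point 0 itself, so the value there
    has to come from continuity.\<close>
  have "(\<zeta> \<longlongrightarrow> \<zeta> 0) (at 0 within {0..})" using \<zeta>(1) by (simp add: continuous_on_def)
  moreover have "at (0::real) within {0..} \<noteq> bot" by (simp add: at_within_Ici_at_right)
  ultimately have "\<zeta> 0 = 0" using \<zeta>(2) tendsto_unique by blast
  \<comment> \<open>The level 1 is chosen below \<open>pi / 2\<close>, which will be a lower bound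
    for the squared distance in phase opposition.\<close>
  with \<zeta>(1) obtain \<eta> where "\<eta> > 0" and \<eta>: "\<And>y. 0 \<le> y \<Longrightarrow> y < \<eta> \<Longrightarrow> \<zeta> y < 1"
  proof -
    from \<zeta>(1)[unfolded continuous_on_iff, rule_format, of 0 1] \<open>\<zeta> 0 = 0\<close>
    obtain d where "d > 0" "\<And>y. 0 \<le> y \<Longrightarrow> \<bar>y\<bar> < d \<Longrightarrow> \<bar>\<zeta> y\<bar> < 1"
      by (auto simp: dist_real_def)
    then show thesis by (intro that[of d]) force+
  qed
  \<comment> \<open>Half of the available exponent \<open>1 - 2*s\<close>: with
    \<open>\<delta> m = m^(-\<sigma>)\<close> the drift rate \<open>m^(1 - 2*s) * \<delta> m\<close>
    is \<open>m^\<sigma>\<close>, so it diverges while the amplitudes merge.\<close>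
  define \<sigma> where "\<sigma> = (1 - 2 * s) / 2"
  have "\<sigma> > 0" using \<open>s < 1/2\<close> by (simp add: \<sigma>_def)
  define \<delta> where "\<delta> m = real m powr (- \<sigma>)" for m
  have \<delta>0: "\<delta> \<longlonglongrightarrow> 0"
    unfolding \<delta>_def using \<open>\<sigma> > 0\<close>
    by (intro tendsto_neg_powr filterlim_real_sequentially) auto
  have "(\<lambda>m. 1 / (2*pi) * (4 * pi\<^sup>2 * (\<delta> m)\<^sup>2 + 400\<^sup>2 * (inverse (real m))^4 * weight_sum))
      \<longlonglongrightarrow> 1 / (2*pi) * (4 * pi\<^sup>2 * 0\<^sup>2 + 400\<^sup>2 * 0^4 * weight_sum)"
    by (intro tendsto_intros \<delta>0 lim_inverse_n)
  then have "\<forall>\<^sub>F m in sequentially.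
      1 / (2*pi) * (4 * pi\<^sup>2 * (\<delta> m)\<^sup>2 + 400\<^sup>2 * (inverse (real m))^4 * weight_sum) < \<eta>\<^sup>2"
    by (rule order_tendstoD) (use \<open>\<eta> > 0\<close> in simp)
  moreover have "\<forall>\<^sub>F m in sequentially. \<delta> m < 1 / 2"
    by (rule order_tendstoD[OF \<delta>0]) simp
  moreover have "filterlim (\<lambda>m. real m powr \<sigma>) at_top sequentially"
    using \<open>\<sigma> > 0\<close> by (intro filterlim_compose[OF real_powr_at_top filterlim_real_sequentially])
  then have "\<forall>\<^sub>F m in sequentially. 4 * (pi / T + 352) \<le> real m powr \<sigma>"
    by (simp add: filterlim_at_top)
  moreover have "\<forall>\<^sub>F m in sequentially. m \<ge> (4::nat)" by (rule eventually_ge_at_top)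
  ultimately have "\<forall>\<^sub>F m in sequentially.
      1 / (2*pi) * (4 * pi\<^sup>2 * (\<delta> m)\<^sup>2 + 400\<^sup>2 * (inverse (real m))^4 * weight_sum) < \<eta>\<^sup>2
      \<and> \<delta> m < 1 / 2 \<and> 4 * (pi / T + 352) \<le> real m powr \<sigma> \<and> m \<ge> 4"
    by eventually_elim blast
  then obtain m :: nat where
    small: "1 / (2*pi) * (4 * pi\<^sup>2 * (\<delta> m)\<^sup>2 + 400\<^sup>2 * (inverse (real m))^4 * weight_sum) < \<eta>\<^sup>2"
    and d2: "\<delta> m < 1 / 2" and gap: "4 * (pi / T + 352) \<le> real m powr \<sigma>" and m4: "m \<ge> 4"
    by (auto dest!: eventually_happens)
  define d where "d = \<delta> m"
  \<comment> \<open>M normalises mode m in the Sobolev norm: \<open>W * M^2\<close> stays between 1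
    and 2, uniformly in m.\<close>
  define M where "M = real m powr (- s)"
  define W where "W = (1 + (real m)\<^sup>2) powr s"
  have m0: "real m > 0" "real m \<ge> 1" using m4 by auto
  have d: "0 < d" "d < 1 / 2" using m0 d2 by (auto simp: d_def \<delta>_def)
  have M: "0 < M" "M \<le> 1"
    using m0 \<open>0 \<le> s\<close> powr_mono[of "-s" 0 "real m"] by (auto simp: M_def)
  have M2: "M\<^sup>2 = real m powr (- 2 * s)"
    using m0 by (simp add: M_def power2_eq_square flip: powr_add)
  have mm: "(real m)\<^sup>2 powr s * M\<^sup>2 = 1"
    using m0 by (simp add: M2 powr_powr flip: powr_numeral powr_add)
  have W1: "1 \<le> W * M\<^sup>2"
  proof -
    have "(real m)\<^sup>2 powr s \<le> W" unfolding W_def using \<open>0 \<le> s\<close> by (intro powr_mono2) auto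
    then show ?thesis using mm mult_right_mono[of "(real m)\<^sup>2 powr s" W "M\<^sup>2"] by simp
  qed
  have W2: "W * M\<^sup>2 \<le> 2"
  proof -
    have "1 \<le> (real m)\<^sup>2" using m0 by simp
    then have "W \<le> (2 * (real m)\<^sup>2) powr s" unfolding W_def using \<open>0 \<le> s\<close> by (intro powr_mono2) auto
    also have "\<dots> = 2 powr s * (real m)\<^sup>2 powr s" by (rule powr_mult)
    also have "\<dots> \<le> 2 powr 1 * (real m)\<^sup>2 powr s"
      using \<open>s < 1/2\<close> by (intro mult_right_mono powr_mono) auto
    finally have "W * M\<^sup>2 \<le> 2 * (real m)\<^sup>2 powr s * M\<^sup>2" by (intro mult_right_mono) auto
    then show ?thesis using mm by simp
  qed
  \<comment> \<open>With base amplitude 1/2 and \<open>d < 1/2\<close> both amplitudes stay at most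
    1, as the wave construction requires.\<close>
  define a1 where "a1 = (1 / 2 + d) * M"
  define a2 where "a2 = 1 / 2 * M"
  have a: "0 < a2" "a2 < a1" "a1 \<le> 1"
  proof -
    show "0 < a2" "a2 < a1" using M d by (simp_all add: a1_def a2_def)
    show "a1 \<le> 1" unfolding a1_def using M d by (intro mult_le_one) auto
  qed
  have "\<bar>\<mu>\<bar> = 1" using assms(4) by auto
  have m4': "352 / (real m)^3 \<le> 352"
    using m0 by (simp add: divide_le_eq one_le_power)
  have "pi / T \<le> real m * ((a1\<^sup>2 - a2\<^sup>2) / 4 - 352 / (real m)^4)"
  proof -
    \<comment> \<open>Only the term linear in d is kept. In the choice of m, the factor 4 offsets
      the 1/4 in the cubic speed shift, and 352 covers the speed error after multiplication by
      m.\<close>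
    have "a1\<^sup>2 - a2\<^sup>2 = (d + d\<^sup>2) * M\<^sup>2" by (simp add: a1_def a2_def power2_eq_square algebra_simps)
    moreover have "d * M\<^sup>2 \<le> (d + d\<^sup>2) * M\<^sup>2" by (intro mult_right_mono) auto
    moreover define X where "X = real m * (a1\<^sup>2 - a2\<^sup>2)"
    ultimately have "real m * (d * M\<^sup>2) \<le> X" unfolding X_def using m0 by (intro mult_left_mono) auto
    also have "real m * (d * M\<^sup>2) = real m powr \<sigma>"
    proof -
      have "real m * (d * M\<^sup>2) = real m powr 1 * (real m powr (- \<sigma>) * real m powr (- 2 * s))"
        using m0 by (simp add: d_def \<delta>_def M2)
      also have "\<dots> = real m powr (1 + (- \<sigma> + - 2 * s))" by (simp only: powr_add)
      also have "1 + (- \<sigma> + - 2 * s) = \<sigma>" by (simp add: \<sigma>_def field_simps)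
      finally show ?thesis .
    qed
    finally have "4 * (pi / T + 352) \<le> X" using gap by (rule order_trans[rotated])
    then have "pi / T \<le> X / 4 - 352" by simp
    also have "\<dots> \<le> X / 4 - 352 / (real m)^3" by (rule diff_left_mono[OF m4'])
    also have "\<dots> = real m * ((a1\<^sup>2 - a2\<^sup>2) / 4 - 352 / (real m)^4)"
      using m0 by (simp add: X_def field_simps power_numeral_reduce)
    finally show ?thesis .
  qed
  then have gap': "pi / T \<le> of_int (int m) * ((a1\<^sup>2 - a2\<^sup>2) / 4 - 352 / (of_int (int m))^4)" by simp
  have s1: "s \<le> 1" and mi: "int m \<ge> 4" using \<open>s < 1/2\<close> m4 by auto
  have m1: "1 / (real m)^4 \<le> 1" using m0 by (simp add: divide_le_eq one_le_power)
  obtain v1 v2 t where v: "mkaw_solution \<beta> \<gamma> \<mu> s T v1" "mkaw_solution \<beta> \<gamma> \<mu> s T v2" "t \<in> {0..T}"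
    "(hs_norm s (v1 0))\<^sup>2 \<le> 1 / (2*pi) * (2 * W * (a1 * pi)\<^sup>2 + 200\<^sup>2 / (real m)^4 * weight_sum)"
    "(hs_norm s (v2 0))\<^sup>2 \<le> 1 / (2*pi) * (2 * W * (a2 * pi)\<^sup>2 + 200\<^sup>2 / (real m)^4 * weight_sum)"
    "(hs_norm s (\<lambda>x. v1 0 x - v2 0 x))\<^sup>2
       \<le> 1 / (2*pi) * (2 * W * ((a1 - a2) * pi)\<^sup>2 + 400\<^sup>2 / (real m)^4 * weight_sum)"
    "1 / (2*pi) * (W * ((a1 + a2) * pi)\<^sup>2) \<le> (hs_norm s (\<lambda>x. v1 t x - v2 t x))\<^sup>2"
    by (rule wave_pair_exists[OF s1 mi \<open>\<beta> \<ge> 0\<close> \<open>\<bar>\<mu>\<bar> = 1\<close> a \<open>T > 0\<close> gap', where \<gamma> = \<gamma>,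
          unfolded of_int_of_nat_eq, folded W_def]) (rule that)
  \<comment> \<open>The values \<open>1/2 + d\<close>, \<open>1/2\<close> and \<open>d\<close> of
    \<kappa> treat the two data and their difference at once.\<close>
  have WM: "2 * W * (\<kappa> * M * pi)\<^sup>2 \<le> 4 * pi\<^sup>2 * \<kappa>\<^sup>2" for \<kappa>
  proof -
    have "2 * W * (\<kappa> * M * pi)\<^sup>2 = (W * M\<^sup>2) * (2 * pi\<^sup>2 * \<kappa>\<^sup>2)"
      by (simp add: power_mult_distrib mult_ac)
    also have "\<dots> \<le> 2 * (2 * pi\<^sup>2 * \<kappa>\<^sup>2)" by (rule mult_right_mono[OF W2]) simp
    finally show ?thesis by simp
  qed
  have norm_le_R: "h \<le> R"
    if "h\<^sup>2 \<le> 1 / (2*pi) * (2 * W * (\<kappa> * M * pi)\<^sup>2 + 200\<^sup>2 / (real m)^4 * weight_sum)" "0 \<le> \<kappa>" "\<kappa> \<le> 1" for h \<kappa>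
  proof -
    have "4 * pi\<^sup>2 * \<kappa>\<^sup>2 \<le> 4 * pi\<^sup>2 * 1" using that by (intro mult_left_mono power_le_one) auto
    with WM[of \<kappa>] have "2 * W * (\<kappa> * M * pi)\<^sup>2 \<le> 4 * pi\<^sup>2" by linarith
    moreover have "200\<^sup>2 * (1 / (real m)^4) * weight_sum \<le> 200\<^sup>2 * 1 * weight_sum"
      using m1 weight_sum_nonneg by (intro mult_right_mono mult_left_mono) auto
    ultimately have "2 * W * (\<kappa> * M * pi)\<^sup>2 + 200\<^sup>2 / (real m)^4 * weight_sum \<le> 4 * pi\<^sup>2 + 200\<^sup>2 * weight_sum"
      by (intro add_mono) simp_all
    then have "1 / (2*pi) * (2 * W * (\<kappa> * M * pi)\<^sup>2 + 200\<^sup>2 / (real m)^4 * weight_sum)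
        \<le> 1 / (2*pi) * (4 * pi\<^sup>2 + 200\<^sup>2 * weight_sum)"
      by (rule mult_left_mono) simp
    with that(1) show ?thesis unfolding R_def by (intro real_le_rsqrt) linarith
  qed
  have R1: "hs_norm s (v1 0) \<le> R" using norm_le_R[OF v(4)[unfolded a1_def]] d by simp
  have R2: "hs_norm s (v2 0) \<le> R" using norm_le_R[OF v(5)[unfolded a2_def]] by simp
  have le: "hs_norm s (\<lambda>x. v1 t x - v2 t x) \<le> \<zeta> (hs_norm s (\<lambda>x. v1 0 x - v2 0 x))"
    by (rule flow[rule_format, OF _ v(3)]) (intro conjI v(1,2) R1 R2)
  define h0 where "h0 = hs_norm s (\<lambda>x. v1 0 x - v2 0 x)"
  define h where "h = hs_norm s (\<lambda>x. v1 t x - v2 t x)"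
  have h: "h0 \<ge> 0" "h \<ge> 0" "h \<le> \<zeta> h0" using le by (simp_all add: h0_def h_def hs_norm_nonneg)
  have "a1 - a2 = d * M" by (simp add: a1_def a2_def algebra_simps)
  with v(6) have "h0\<^sup>2 \<le> 1 / (2*pi) * (2 * W * (d * M * pi)\<^sup>2 + 400\<^sup>2 / (real m)^4 * weight_sum)"
    by (simp only: h0_def)
  also have "\<dots> \<le> 1 / (2*pi) * (4 * pi\<^sup>2 * d\<^sup>2 + 400\<^sup>2 * (inverse (real m))^4 * weight_sum)"
    by (rule mult_left_mono[OF add_mono[OF WM]]) (simp_all add: inverse_eq_divide power_one_over)
  also have "\<dots> < \<eta>\<^sup>2" using small by (simp only: d_def)
  finally have "h0 < \<eta>"
    by (rule power_less_imp_less_base) (use \<open>\<eta> > 0\<close> in simp)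
  then have "h < 1" using \<eta>[OF h(1)] h(3) by linarith
  then have "h\<^sup>2 < 1" using h(2) power_strict_mono[of h 1 2] by simp
  \<comment> \<open>Here \<open>a1 + a2 = (1 + d) * M\<close>, so M cancels against W up to a factor
    at least 1, and the bound is uniform in m.\<close>
  moreover have "1 < 1 / (2*pi) * (W * ((a1 + a2) * pi)\<^sup>2)"
  proof -
    have "1 / (2*pi) * (W * ((a1 + a2) * pi)\<^sup>2) = (W * M\<^sup>2) * (1 + d)\<^sup>2 * (pi / 2)"
      by (simp add: a1_def a2_def power2_eq_square field_simps)
    moreover have "1 * 1 * (pi / 2) \<le> (W * M\<^sup>2) * (1 + d)\<^sup>2 * (pi / 2)"
      using W1 d by (intro mult_right_mono mult_mono) auto
    moreover have "1 < pi / 2" using pi_gt3 by simp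
    ultimately show ?thesis by linarith
  qed
  moreover have "1 / (2*pi) * (W * ((a1 + a2) * pi)\<^sup>2) \<le> h\<^sup>2" unfolding h_def by (rule v(7))
  ultimately show False by linarith
qed

end
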